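(* Let $1\le p\le 2$ and let $\mu$ be a positive Borel measure on $[0,1)$ which is a $1$-Carleson measure. Then $\mathcal{DH}_\mu$ is a bounded operator from $H^p$ into $H^p$ if and only if $\mu$ is a $2$-Carleson measure.
   Context: $\mathbb{D}$ is the open unit disc in $\mathbb{C}$. For $0<p<\infty$, the Hardy space $H^p$ consists of all analytic $f$ on $\mathbb{D}$ with $\|f\|_{H^p}=\sup_{0<r<1}\left(\frac1{2\pi}\int_0^{2\pi}|f(re^{i\theta})|^p\,d\theta\right)^{1/p}<\infty$. For a positive Borel measure $\mu$ on $[0,1)$, let $\mu_n=\int_{[0,1)}t^n\,d\mu(t)$, and for $f(z)=\sum_{k=0}^\infty a_kz^k$ analytic on $\mathbb{D}$ put $$\mathcal{DH}_\mu(f)(z)=\sum_{n=0}^\infty (n+1)\Big(\sum_{k=0}^\infty \mu_{n+k}a_k\Big)z^n .$$ When $1\le p<\infty$ and $\mu$ is a $1$-Carleson measure, this is a well-defined analytic function on $\mathbb{D}$ for every $f\in H^p$. For $s>0$, a positive Borel measure $\mu$ on $[0,1)$ is an $s$-Carleson measure if there is a constant $C>0$ with $\mu([t,1))\le C(1-t)^s$ for all $0\le t<1$. *)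

theory Defs
  imports "HOL-Complex_Analysis.Complex_Analysis"
begin

definition integral_mean :: "real \<Rightarrow> (complex \<Rightarrow> complex) \<Rightarrow> real \<Rightarrow> real" where
  "integral_mean p f r =
     (1 / (2 * pi) * integral {0..2 * pi} (\<lambda>\<theta>. norm (f (of_real r * cis \<theta>)) powr p)) powr (1 / p)"

definition hardy_norm :: "real \<Rightarrow> (complex \<Rightarrow> complex) \<Rightarrow> ennreal" where
  "hardy_norm p f = (SUP r\<in>{0<..<1}. ennreal (integral_mean p f r))"

(* Elements are total functions of which only the restriction to the unit disc matters. *)
definition hardy_space :: "real \<Rightarrow> (complex \<Rightarrow> complex) set" where
  "hardy_space p = {f. f holomorphic_on ball 0 1 \<and> hardy_norm p f < \<infinity>}"

(* The Borel measures on [0,1): the type of the measure is real measure, but its space is [0,1). *)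
definition borel_measure_01 :: "real measure \<Rightarrow> bool" where
  "borel_measure_01 \<mu> \<longleftrightarrow> sets \<mu> = sets (restrict_space borel {0..<1})"

definition carleson_measure :: "real \<Rightarrow> real measure \<Rightarrow> bool" where
  "carleson_measure s \<mu> \<longleftrightarrow>
     (\<exists>C>0. \<forall>t. 0 \<le> t \<and> t < 1 \<longrightarrow> emeasure \<mu> {t..<1} \<le> ennreal (C * (1 - t) powr s))"

definition moment :: "real measure \<Rightarrow> nat \<Rightarrow> real" where
  "moment \<mu> n = (\<integral>t. t ^ n \<partial>\<mu>)"

definition taylor_coeff :: "(complex \<Rightarrow> complex) \<Rightarrow> nat \<Rightarrow> complex" where
  "taylor_coeff f k = (deriv ^^ k) f 0 / fact k"

(* Both series converge for z in the unit disc when f is in H^p with p >= 1 and \<mu> is a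
   1-Carleson measure; outside that situation suminf may be an unspecified value. *)
definition DH :: "real measure \<Rightarrow> (complex \<Rightarrow> complex) \<Rightarrow> complex \<Rightarrow> complex" where
  "DH \<mu> f z =
     (\<Sum>n. of_nat (n + 1) * (\<Sum>k. of_real (moment \<mu> (n + k)) * taylor_coeff f k) * z ^ n)"

definition bounded_on_hardy ::
    "real \<Rightarrow> real \<Rightarrow> ((complex \<Rightarrow> complex) \<Rightarrow> complex \<Rightarrow> complex) \<Rightarrow> bool" where
  "bounded_on_hardy p q T \<longleftrightarrow>
     (\<forall>f\<in>hardy_space p. T f \<in> hardy_space q) \<and>
     (\<exists>C::real. C \<ge> 0 \<and> (\<forall>f\<in>hardy_space p. hardy_norm q (T f) \<le> ennreal C * hardy_norm p f))"

end

theory Submission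
  imports Defs "HOL-Real_Asymp.Real_Asymp"
begin

text \<open>
  For \<open>f\<close> analytic past the closed disc, \<open>DH \<mu> f z\<close> is the integral of \<open>f t / (1 - t z)\<^sup>2\<close>
  against \<open>\<mu>\<close>.

  Suppose \<open>\<mu>\<close> is 2-Carleson. Jensen's inequality for the measure \<open>\<bar>1 - t z\<bar> powr (-5/2) d\<mu>(t)\<close>,
  whose mass is at most a constant times \<open>\<bar>1 - z\<bar> powr (-1/2)\<close>, bounds \<open>\<bar>DH \<mu> f z\<bar> powr p\<close> by the
  integral of \<open>\<bar>f t\<bar> powr p * \<bar>1 - z\<bar> powr (-1/2) * \<bar>1 - t z\<bar> powr (-3/2)\<close>. Integrating over
  \<open>\<bar>z\<bar> = r\<close> leaves \<open>\<bar>f t\<bar> powr p / (1 - t) d\<mu>(t)\<close>. Replacing the zeros of \<open>f\<close> by Blaschke factors and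
  taking a power of the remaining zero-free function gives \<open>F\<close> with \<open>\<bar>f\<bar> powr p \<le> \<bar>F\<bar>\<^sup>2\<close> inside the disc
  and equality on the circle; the embedding is then the case of \<open>H\<^sup>2\<close>, which is a weighted
  Cauchy-Schwarz estimate for the Taylor coefficients of \<open>F\<close>. General \<open>f\<close> follow by dilation and
  Fatou's lemma.

  Conversely, \<open>f z = 1 / (1 - b z)\<^sup>2\<close> has norm at most \<open>(1 - b) powr (1/p - 2)\<close>, while
  \<open>DH \<mu> f b\<close> is at least \<open>\<mu> [b, 1) / (1 - b\<^sup>2) ^ 4\<close>; the growth estimate
  \<open>\<bar>g b\<bar> powr p \<le> \<parallel>g\<parallel> powr p / (1 - b\<^sup>2)\<close> for \<open>g = DH \<mu> f\<close> yields \<open>\<mu> [b, 1) \<le> C (1 - b)\<^sup>2\<close>.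
\<close>

section \<open>Series in powers of the square root of the index\<close>

text \<open>With the kernel's own weight, exponent -2, the mass against a 2-Carleson measure can
  grow like log (1 / |1 - z|); an exponent beyond -2 leaves a pure power of |1 - z|. The value -5/2
  keeps everything within square roots: (1 - t)^(-3/2) has coefficients comparable to sqrt (j + 1),
  and the angular kernel has an elementary antiderivative. All integrals against the measure then
  rest on one fact, the moment bound O(1 / (n + 1)^2).

  Two obstacles shape the passage to general \<open>f\<close>. Taylor coefficients of an H^p
  function need not be absolutely summable, so the integral representation is proved only past the
  closed disc, and dilations return to \<open>f\<close> through dominated convergence in the
  defining series. The power of a function exists only without zeros, on the circle too, so only
  radii that meet no zero of \<open>f\<close> serve as dilation factors.

  In the necessity part the measure enters through its finiteness alone, so \<open>DH\<close> is
  estimated there by its series, whose terms are nonnegative for the test function at the point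
  b.\<close>

lemma sqrt_series:
  fixes w :: real
  assumes "0 \<le> w" "w < 1"
  shows summable_sqrt_series: "summable (\<lambda>j. sqrt (Suc j) * w ^ j)"
    and sqrt_series_le: "(\<Sum>j. sqrt (Suc j) * w ^ j) \<le> 1 / sqrt (1 - w) ^ 3"
proof -
  define s where "s = sqrt (1 - w)"
  have s: "s > 0" "s\<^sup>2 = 1 - w" using assms by (auto simp: s_def)
  have geo: "(\<lambda>j. w ^ j) sums (1 / (1 - w))"
    using assms by (intro geometric_sums) auto
  have der: "(\<lambda>j. real (Suc j) * w ^ j) sums (1 / (1 - w)^2)"
    using assms geometric_deriv_sums[of w] by simp
  have sm: "(\<lambda>j. 1/2 * (s * (real (Suc j) * w ^ j) + 1 / s * w ^ j))
      sums (1/2 * (s * (1 / (1 - w)^2) + 1 / s * (1 / (1 - w))))"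
    by (intro sums_mult sums_add geo der)
  \<comment> \<open>The right-hand side is the tangent to the square root at N = 1 / (1 - w), the
    scale on which the series lives; after summation both halves contribute
    \<open>1 / (2 * s ^ 3)\<close>.\<close>
  have "sqrt N \<le> 1/2 * (s * N + 1 / s)" if "N \<ge> 0" for N
  proof -
    have "0 \<le> (s * sqrt N - 1)\<^sup>2" by simp
    also have "\<dots> = s\<^sup>2 * N - 2 * s * sqrt N + 1"
      using that by (simp add: power2_eq_square algebra_simps)
    finally show ?thesis using s(1) by (simp add: field_simps power2_eq_square)
  qed
  from this[of "real (Suc _)"]
  have le: "sqrt (Suc j) * w ^ j \<le> 1/2 * (s * (real (Suc j) * w ^ j) + 1 / s * w ^ j)" for j
    using mult_right_mono[of "sqrt (Suc j)" "1/2 * (s * real (Suc j) + 1 / s)" "w ^ j"] assms(1)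
    by (simp add: algebra_simps)
  show sum: "summable (\<lambda>j. sqrt (Suc j) * w ^ j)"
    by (rule summable_comparison_test'[OF sums_summable[OF sm], of 0]) (use le assms in auto)
  have "(\<Sum>j. sqrt (Suc j) * w ^ j) \<le> 1/2 * (s * (1 / (1 - w)^2) + 1 / s * (1 / (1 - w)))"
    using suminf_le[OF le sum sums_summable[OF sm]] sums_unique[OF sm] by simp
  also have "\<dots> = 1 / s ^ 3"
    using s(1) by (simp flip: s(2) add: field_simps power2_eq_square power3_eq_cube)
  finally show "(\<Sum>j. sqrt (Suc j) * w ^ j) \<le> 1 / sqrt (1 - w) ^ 3"
    by (simp add: s_def)
qed

lemma inverse_sqrt_le_diff_sqrt: "1 / sqrt (Suc j) \<le> 2 * (sqrt (Suc j) - sqrt j)"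
proof -
  have "(sqrt (Suc j) - sqrt j) * (sqrt (Suc j) + sqrt j) = 1"
    by (simp add: algebra_simps)
  moreover have "(sqrt (Suc j) - sqrt j) * (sqrt (Suc j) + sqrt j) \<le> (sqrt (Suc j) - sqrt j) * (2 * sqrt (Suc j))"
    by (intro mult_left_mono) auto
  ultimately show ?thesis by (simp add: field_simps)
qed

text \<open>The differences sqrt (j + 1) - sqrt j dominate half of 1 / sqrt (j + 1). Hence the upper
  bound for the series of square roots passes down to the inverse square roots, and a lower bound
  for the inverse square roots passes up to the square roots.\<close>

lemma inverse_sqrt_series:
  fixes w :: real
  assumes "0 \<le> w" "w < 1"
  shows summable_inverse_sqrt_series: "summable (\<lambda>j. w ^ j / sqrt (Suc j))"
    and inverse_sqrt_series_le: "(\<Sum>j. w ^ j / sqrt (Suc j)) \<le> 2 / sqrt (1 - w)"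
    and sqrt_series_ge: "1 / (2 * sqrt (1 - w) ^ 3) \<le> (\<Sum>j. sqrt (Suc j) * w ^ j)"
proof -
  define s where "s = sqrt (1 - w)"
  have s: "s > 0" "s\<^sup>2 = 1 - w" using assms by (auto simp: s_def)
  have geo: "(\<lambda>j. w ^ j) sums (1 / (1 - w))"
    using assms by (intro geometric_sums) auto
  have der: "(\<lambda>j. real (Suc j) * w ^ j) sums (1 / (1 - w)^2)"
    using assms geometric_deriv_sums[of w] by simp
  define S where "S = (\<Sum>j. sqrt (Suc j) * w ^ j)"
  have S: "(\<lambda>j. sqrt (Suc j) * w ^ j) sums S"
    unfolding S_def by (intro summable_sums summable_sqrt_series assms)
  have shift: "(\<lambda>j. sqrt j * w ^ j) sums (w * S)"
  proof -
    have "(\<lambda>j. sqrt (Suc j) * w ^ Suc j) sums (w * S)"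
      using sums_mult[OF S, of w] by (simp add: mult_ac)
    then show ?thesis by (subst (asm) sums_Suc_iff) simp
  qed
  \<comment> \<open>Multiplying the series of \<open>sqrt (Suc j)\<close> by \<open>1 - w\<close> turns its coefficients into differences.\<close>
  have tel: "(\<lambda>j. 2 * (sqrt (Suc j) - sqrt j) * w ^ j) sums (2 * s\<^sup>2 * S)"
    using sums_mult[OF sums_diff[OF S shift], of 2] by (simp add: algebra_simps s)
  have le: "w ^ j / sqrt (Suc j) \<le> 2 * (sqrt (Suc j) - sqrt j) * w ^ j" for j
    using mult_right_mono[OF inverse_sqrt_le_diff_sqrt, of "w ^ j" j] assms(1) by simp
  show sum: "summable (\<lambda>j. w ^ j / sqrt (Suc j))"
    by (rule summable_comparison_test'[OF sums_summable[OF tel], of 0]) (use le assms in auto)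
  have le_tel: "(\<Sum>j. w ^ j / sqrt (Suc j)) \<le> 2 * s\<^sup>2 * S"
    using suminf_le[OF le sum sums_summable[OF tel]] sums_unique[OF tel] by simp
  also have "\<dots> \<le> 2 * s\<^sup>2 * (1 / s ^ 3)"
    using sqrt_series_le[OF assms] by (intro mult_left_mono) (auto simp: S_def s_def)
  also have "\<dots> = 2 / s"
    using s(1) by (simp add: field_simps power2_eq_square power3_eq_cube)
  finally show "(\<Sum>j. w ^ j / sqrt (Suc j)) \<le> 2 / sqrt (1 - w)" by (simp add: s_def)
  have sm: "(\<lambda>j. s * (3/2 * w ^ j - s\<^sup>2/2 * (real (Suc j) * w ^ j)))
      sums (s * (3/2 * (1 / (1 - w)) - s\<^sup>2/2 * (1 / (1 - w)^2)))"
    by (intro sums_mult sums_diff geo der)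
  \<comment> \<open>Tangent to the convex function 1 / sqrt N at \<open>N = 1 / s\<^sup>2\<close>;
    with v = s sqrt N the gap is (v - 1)^2 (v + 2) up to a positive factor.\<close>
  have tangent: "s * (3/2 - s\<^sup>2/2 * N) \<le> 1 / sqrt N" if "N > 0" for N
  proof -
    define v where "v = s * sqrt N"
    have v: "v > 0" using that s(1) by (simp add: v_def)
    have "0 \<le> (v - 1)\<^sup>2 * (v + 2)" using v by (intro mult_nonneg_nonneg) auto
    then have "v * (3 - v\<^sup>2) \<le> 2" by (simp add: power2_eq_square algebra_simps)
    moreover have "v\<^sup>2 = s\<^sup>2 * N" using that by (simp add: v_def power_mult_distrib)
    ultimately have "sqrt N * (s * (3/2 - s\<^sup>2/2 * N)) \<le> 1"
      using that s(1) by (simp add: v_def field_simps)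
    then show ?thesis using that by (simp add: field_simps)
  qed
  have "s * (3/2 * w ^ j - s\<^sup>2/2 * (real (Suc j) * w ^ j)) \<le> w ^ j / sqrt (Suc j)" for j
    using mult_right_mono[OF tangent[of "real (Suc j)"], of "w ^ j"] assms(1)
    by (simp add: algebra_simps add_divide_distrib)
  from suminf_le[OF this sums_summable[OF sm] sum] sums_unique[OF sm]
  have "s * (3/2 * (1 / (1 - w)) - s\<^sup>2/2 * (1 / (1 - w)^2)) \<le> 2 * s\<^sup>2 * S" using le_tel by simp
  moreover have "s * (3/2 * (1 / (1 - w)) - s\<^sup>2/2 * (1 / (1 - w)^2)) = 1 / s"
    using s(1) by (simp flip: s(2) add: field_simps power2_eq_square power3_eq_cube)
  ultimately have "1 / s / (2 * s\<^sup>2) \<le> S"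
    using s(1) by (simp add: divide_le_eq mult_ac)
  moreover have "1 / s / (2 * s\<^sup>2) = 1 / (2 * s ^ 3)"
    using s(1) by (simp add: power2_eq_square power3_eq_cube)
  ultimately show "1 / (2 * sqrt (1 - w) ^ 3) \<le> (\<Sum>j. sqrt (Suc j) * w ^ j)"
    by (simp only: s_def S_def)
qed

text \<open>A telescoping majorant. For the consecutive roots \<open>a\<close> and \<open>b\<close>
  the difference of reciprocals is 1 / (a b (a + b)), and b^2 \<le> 2 a^2 bounds b (a + b) by 4
  a^2.\<close>

lemma three_halves_le_diff_inverse_sqrt:
  "1 / (real (Suc n) * sqrt (Suc n)) \<le> 4 * (1 / sqrt (Suc n) - 1 / sqrt (Suc (Suc n)))"
proof -
  define a b where "a = sqrt (Suc n)" and "b = sqrt (Suc (Suc n))"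
  have ab: "a \<ge> 1" "b > 0" "b\<^sup>2 = a\<^sup>2 + 1" "a\<^sup>2 = Suc n" "a \<le> b" by (auto simp: a_def b_def)
  have "b\<^sup>2 \<le> 2 * a\<^sup>2" using ab(1) by (simp add: ab(3))
  moreover have "b * a \<le> b * b" using ab(2,5) by (intro mult_left_mono) auto
  ultimately have "b * (a + b) \<le> 4 * a\<^sup>2"
    by (simp add: distrib_left power2_eq_square)
  then have "b * (a + b) * (b - a) \<le> 4 * a\<^sup>2 * (b - a)" using ab by (intro mult_right_mono) auto
  moreover have "b * (a + b) * (b - a) = b"
    using ab(3) by (simp add: algebra_simps power2_eq_square)
  ultimately have "1 / (a\<^sup>2 * a) \<le> 4 * (1 / a - 1 / b)"
    using ab(1,2) by (simp add: field_simps power2_eq_square)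
  then show ?thesis by (simp add: ab(4) a_def b_def)
qed

lemma sums_diff_inverse_sqrt:
  "(\<lambda>i. 1 / sqrt (Suc (i + j)) - 1 / sqrt (Suc (Suc (i + j)))) sums (1 / sqrt (Suc j))"
proof -
  have "(\<lambda>i. 1 / sqrt (real (Suc (i + j)))) \<longlonglongrightarrow> 0" by real_asymp
  from telescope_sums'[OF this] show ?thesis by simp
qed

section \<open>Integrals against a 2-Carleson measure\<close>

text \<open>Up to sign, 1 - z and 1 - t z differ by (1 - t) z, whose norm is at most 1 - t and hence
  again at most |1 - t z|; this costs the factor 2.\<close>

lemma norm_one_minus_le_norm_one_minus_mult:
  fixes z :: complex
  assumes "norm z \<le> 1" "0 \<le> t" "t \<le> 1"
  shows "1 - t \<le> norm (1 - of_real t * z)" "norm (1 - z) \<le> 2 * norm (1 - of_real t * z)"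
proof -
  have "t * norm z \<le> t * 1" using assms by (intro mult_left_mono) auto
  then show le: "1 - t \<le> norm (1 - of_real t * z)"
    using norm_triangle_ineq2[of 1 "of_real t * z"] assms by (simp add: norm_mult)
  have "1 - z = (1 - of_real t * z) - of_real (1 - t) * z" by (simp add: algebra_simps)
  then have "norm (1 - z) \<le> norm (1 - of_real t * z) + norm (of_real (1 - t) * z)"
    by (metis norm_triangle_ineq4)
  also have "norm (of_real (1 - t) * z) = (1 - t) * norm z"
    using assms unfolding norm_mult norm_of_real by simp
  also have "(1 - t) * norm z \<le> (1 - t) * 1" using assms by (intro mult_left_mono) auto
  finally show "norm (1 - z) \<le> 2 * norm (1 - of_real t * z)" using le by simp
qed

lemma summable_norm_square:
  fixes A :: "nat \<Rightarrow> complex"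
  assumes A: "summable (\<lambda>k. norm (A k))"
  shows "summable (\<lambda>k. (norm (A k))\<^sup>2)"
proof (rule summable_comparison_test'[OF summable_mult[OF A, of "\<Sum>k. norm (A k)"], of 0])
  fix k
  have "norm (A k) \<le> (\<Sum>k. norm (A k))"
    using sum_le_suminf[OF A, of "{k}"] by simp
  then show "norm ((norm (A k))\<^sup>2) \<le> (\<Sum>k. norm (A k)) * norm (A k)"
    by (simp add: power2_eq_square mult_right_mono)
qed

locale borel_01 =
  fixes \<mu> :: "real measure"
  assumes sets_mu: "sets \<mu> = sets (restrict_space borel {0..<1})"
begin

lemma space_mu: "space \<mu> = {0..<1}"
  using sets_eq_imp_space_eq[OF sets_mu] by (simp add: space_restrict_space)

lemma tail_sets: "0 \<le> t \<Longrightarrow> {t..<1} \<in> sets \<mu>"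
  unfolding sets_mu by (subst sets_restrict_space_iff) auto

lemma measurable_ident_mu [measurable]: "(\<lambda>t. t) \<in> borel_measurable \<mu>"
proof -
  have "(\<lambda>t. t) \<in> borel_measurable (restrict_space borel {0..<1::real})"
    by (intro measurable_restrict_space1) simp
  then show ?thesis by (simp add: sets_mu cong: measurable_cong_sets)
qed

lemma borel_measurable_muI:
  fixes f :: "real \<Rightarrow> 'a::topological_space"
  assumes "continuous_on {0..<1} f"
  shows "f \<in> borel_measurable \<mu>"
  using borel_measurable_continuous_on_restrict[OF assms]
  by (simp add: sets_mu cong: measurable_cong_sets)

end

locale carleson_2 = borel_01 \<mu> for \<mu> :: "real measure" +
  fixes C :: real
  assumes C_pos: "C > 0"
    and tail: "\<And>t. 0 \<le> t \<Longrightarrow> t < 1 \<Longrightarrow> emeasure \<mu> {t..<1} \<le> ennreal (C * (1 - t)\<^sup>2)"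
begin

lemma finite_mu: "finite_measure \<mu>"
proof
  have "emeasure \<mu> {0..<1} \<le> ennreal (C * (1 - 0)\<^sup>2)" by (rule tail) auto
  then show "emeasure \<mu> (space \<mu>) \<noteq> \<infinity>"
    unfolding space_mu by (auto simp: top_unique)
qed

text \<open>The bound \<open>exp 1 * exp (-1) ^ j\<close> for \<open>t ^ n\<close> on a layer times
  the tail bound C ((j + 1) / N)^2, summed over the layers with N = n + 1 and 1 / N^2 taken
  out.\<close>

definition moment_const :: real where
  "moment_const = C * exp 1 * (\<Sum>j. (real (Suc j))\<^sup>2 * exp (-1) ^ j)"

lemma summable_sq_exp: "summable (\<lambda>j. (real (Suc j))\<^sup>2 * exp (-1) ^ j)"
proof -
  have "(\<lambda>j. (real (Suc j))\<^sup>2 * exp (-1) ^ j) \<in> O(\<lambda>j. exp (-1/2) ^ j)"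
    by real_asymp
  then show ?thesis
    by (rule summable_comparison_test_bigo[rotated]) (simp add: summable_geometric)
qed

lemma moment_const_nonneg: "moment_const \<ge> 0"
  unfolding moment_const_def using C_pos
  by (intro mult_nonneg_nonneg suminf_nonneg summable_sq_exp) auto

lemma nn_integral_power_le:
  "(\<integral>\<^sup>+ t. ennreal (t ^ n) \<partial>\<mu>) \<le> ennreal (moment_const / (real (Suc n))\<^sup>2)"
proof -
  define N where "N = real (Suc n)"
  have N: "N > 0" by (simp add: N_def)
  \<comment> \<open>On the layer \<open>j \<le> N (1 - t) < j + 1\<close> the integrand is at most \<open>exp (1 - j)\<close>.\<close>
  define a where "a j = max 0 (1 - real (Suc j) / N)" for j
  have a: "0 \<le> a j" "a j < 1" for j by (auto simp: a_def N)
  have pw: "ennreal (t ^ n) \<le> (\<Sum>j. ennreal (exp 1 * exp (-1) ^ j) * indicator {a j..<1} t)"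
    if "t \<in> space \<mu>" for t
  proof -
    have t: "0 \<le> t" "t < 1" using that by (auto simp: space_mu)
    define j where "j = nat \<lfloor>N * (1 - t)\<rfloor>"
    have j: "real j \<le> N * (1 - t)" "N * (1 - t) < real (Suc j)"
      using t N by (simp_all add: j_def) linarith
    have ind: "t \<in> {a j..<1}" using t j N by (auto simp: a_def field_simps)
    have "t ^ n \<le> exp (- (1 - t)) ^ n"
      using exp_ge_add_one_self[of "-(1-t)"] t by (intro power_mono) auto
    \<comment> \<open>The exponent of \<open>t ^ n\<close> is N - 1; the missing factor costs exp (1
      - t), at most exp 1.\<close>
    also have "\<dots> = exp (1 - t) * exp (- (N * (1 - t)))"
      by (simp add: N_def exp_of_nat_mult[symmetric] algebra_simps flip: exp_add)
    also have "\<dots> \<le> exp 1 * exp (- real j)"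
      using t j by (intro mult_mono) auto
    also have "exp (- real j) = exp (-1) ^ j" by (simp flip: exp_of_nat_mult)
    finally have "ennreal (t ^ n) \<le> ennreal (exp 1 * exp (-1) ^ j)" by (rule ennreal_leI)
    also have "\<dots> = (\<Sum>i\<in>{j}. ennreal (exp 1 * exp (-1) ^ i) * indicator {a i..<1} t)"
      using ind by simp
    also have "\<dots> \<le> (\<Sum>i. ennreal (exp 1 * exp (-1) ^ i) * indicator {a i..<1} t)"
      by (intro sum_le_suminf) auto
    finally show ?thesis .
  qed
  have "(\<integral>\<^sup>+ t. ennreal (t ^ n) \<partial>\<mu>) \<le> (\<integral>\<^sup>+ t. (\<Sum>j. ennreal (exp 1 * exp (-1) ^ j) * indicator {a j..<1} t) \<partial>\<mu>)"
    by (intro nn_integral_mono pw)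
  also have "\<dots> = (\<Sum>j. \<integral>\<^sup>+ t. ennreal (exp 1 * exp (-1) ^ j) * indicator {a j..<1} t \<partial>\<mu>)"
    using tail_sets[OF a(1)] by (intro nn_integral_suminf) auto
  also have "\<dots> = (\<Sum>j. ennreal (exp 1 * exp (-1) ^ j) * emeasure \<mu> {a j..<1})"
    using tail_sets[OF a(1)] by (intro suminf_cong nn_integral_cmult_indicator) auto
  also have "\<dots> \<le> (\<Sum>j. ennreal (C * exp 1 / N\<^sup>2 * ((real (Suc j))\<^sup>2 * exp (-1) ^ j)))"
  proof (intro suminf_le)
    fix j
    have "emeasure \<mu> {a j..<1} \<le> ennreal (C * (1 - a j)\<^sup>2)" by (rule tail[OF a])
    also have "\<dots> \<le> ennreal (C * (real (Suc j) / N)\<^sup>2)"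
      using C_pos a(2)[of j] by (intro ennreal_leI mult_left_mono power_mono) (auto simp: a_def)
    finally have "ennreal (exp 1 * exp (-1) ^ j) * emeasure \<mu> {a j..<1}
        \<le> ennreal (exp 1 * exp (-1) ^ j) * ennreal (C * (real (Suc j) / N)\<^sup>2)"
      by (intro mult_left_mono) auto
    also have "\<dots> = ennreal (C * exp 1 / N\<^sup>2 * ((real (Suc j))\<^sup>2 * exp (-1) ^ j))"
      using C_pos by (subst ennreal_mult[symmetric]) (auto simp: field_simps)
    finally show "ennreal (exp 1 * exp (-1) ^ j) * emeasure \<mu> {a j..<1}
      \<le> ennreal (C * exp 1 / N\<^sup>2 * ((real (Suc j))\<^sup>2 * exp (-1) ^ j))" .
  qed auto
  also have "\<dots> = ennreal (\<Sum>j. C * exp 1 / N\<^sup>2 * ((real (Suc j))\<^sup>2 * exp (-1) ^ j))"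
    using C_pos by (intro suminf_ennreal2 summable_mult summable_sq_exp) auto
  also have "(\<Sum>j. C * exp 1 / N\<^sup>2 * ((real (Suc j))\<^sup>2 * exp (-1) ^ j)) = moment_const / N\<^sup>2"
    by (subst suminf_mult[OF summable_sq_exp]) (simp add: moment_const_def)
  finally show ?thesis by (simp add: N_def)
qed

text \<open>Expanding (1 - t)^(-3/2) with coefficients sqrt (i + 1) reduces the integral to moments
  of order i + j. As sqrt (i + 1) \<le> sqrt (i + j + 1), the terms are at most a constant times (i
  + j + 1)^(-3/2), and their sum telescopes. The model is the density 1 - t, where the integral is a
  Beta function of the same order.\<close>

lemma nn_integral_power_div_le:
  "(\<integral>\<^sup>+ t. ennreal (t ^ j / sqrt (1 - t) ^ 3) \<partial>\<mu>) \<le> ennreal (8 * moment_const / sqrt (Suc j))"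
proof -
  have "(\<integral>\<^sup>+ t. ennreal (t ^ j / sqrt (1 - t) ^ 3) \<partial>\<mu>)
      \<le> (\<integral>\<^sup>+ t. (\<Sum>i. ennreal (2 * sqrt (Suc i)) * ennreal (t ^ (i + j))) \<partial>\<mu>)"
  proof (rule nn_integral_mono)
    fix t assume "t \<in> space \<mu>"
    then have t: "0 \<le> t" "t < 1" by (auto simp: space_mu)
    have sm: "summable (\<lambda>i. 2 * t ^ j * (sqrt (Suc i) * t ^ i))"
      by (intro summable_mult summable_sqrt_series t)
    have "t ^ j / sqrt (1 - t) ^ 3 \<le> 2 * t ^ j * (\<Sum>i. sqrt (Suc i) * t ^ i)"
      using mult_left_mono[OF sqrt_series_ge[OF t], of "2 * t ^ j"] t by simp
    also have "\<dots> = (\<Sum>i. 2 * t ^ j * (sqrt (Suc i) * t ^ i))"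
      by (subst suminf_mult[OF summable_sqrt_series[OF t]]) simp
    finally have "ennreal (t ^ j / sqrt (1 - t) ^ 3) \<le> ennreal (\<Sum>i. 2 * t ^ j * (sqrt (Suc i) * t ^ i))"
      by (rule ennreal_leI)
    also have "\<dots> = (\<Sum>i. ennreal (2 * t ^ j * (sqrt (Suc i) * t ^ i)))"
      using t by (intro suminf_ennreal2[symmetric] sm) auto
    also have "\<dots> = (\<Sum>i. ennreal (2 * sqrt (Suc i)) * ennreal (t ^ (i + j)))"
      using t by (intro suminf_cong, subst ennreal_mult[symmetric]) (auto simp: power_add mult_ac)
    finally show "ennreal (t ^ j / sqrt (1 - t) ^ 3) \<le> (\<Sum>i. ennreal (2 * sqrt (Suc i)) * ennreal (t ^ (i + j)))" .
  qed
  also have "\<dots> = (\<Sum>i. ennreal (2 * sqrt (Suc i)) * (\<integral>\<^sup>+ t. ennreal (t ^ (i + j)) \<partial>\<mu>))"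
    by (subst nn_integral_suminf) (auto simp: nn_integral_cmult)
  also have "\<dots> \<le> (\<Sum>i. ennreal (8 * moment_const * (1 / sqrt (Suc (i + j)) - 1 / sqrt (Suc (Suc (i + j))))))"
  proof (intro suminf_le)
    fix i
    define n where "n = i + j"
    have "ennreal (2 * sqrt (Suc i)) * (\<integral>\<^sup>+ t. ennreal (t ^ n) \<partial>\<mu>)
        \<le> ennreal (2 * sqrt (Suc n)) * ennreal (moment_const / (real (Suc n))\<^sup>2)"
      by (intro mult_mono ennreal_leI nn_integral_power_le) (auto simp: n_def)
    also have "\<dots> = ennreal (2 * moment_const * (1 / (real (Suc n) * sqrt (Suc n))))"
    proof (subst ennreal_mult[symmetric])
      have "2 * q * (moment_const / (q\<^sup>2)\<^sup>2) = 2 * moment_const * (1 / (q\<^sup>2 * q))" if "q > 0" for q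
        using that by (simp add: field_simps power2_eq_square)
      from this[of "sqrt (Suc n)"]
      show "ennreal (2 * sqrt (Suc n) * (moment_const / (real (Suc n))\<^sup>2))
          = ennreal (2 * moment_const * (1 / (real (Suc n) * sqrt (Suc n))))"
        by simp
    qed (use moment_const_nonneg in auto)
    also have "\<dots> \<le> ennreal (2 * moment_const * (4 * (1 / sqrt (Suc n) - 1 / sqrt (Suc (Suc n)))))"
      using moment_const_nonneg
      by (intro ennreal_leI mult_left_mono three_halves_le_diff_inverse_sqrt) auto
    finally show "ennreal (2 * sqrt (Suc i)) * (\<integral>\<^sup>+ t. ennreal (t ^ (i + j)) \<partial>\<mu>)
        \<le> ennreal (8 * moment_const * (1 / sqrt (Suc (i + j)) - 1 / sqrt (Suc (Suc (i + j)))))"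
      by (simp add: n_def mult_ac)
  qed auto
  also have "\<dots> = ennreal (\<Sum>i. 8 * moment_const * (1 / sqrt (Suc (i + j)) - 1 / sqrt (Suc (Suc (i + j)))))"
    using moment_const_nonneg sums_diff_inverse_sqrt[of j, THEN sums_summable]
    by (intro suminf_ennreal2 summable_mult mult_nonneg_nonneg) (auto simp: field_simps)
  also have "(\<Sum>i. 8 * moment_const * (1 / sqrt (Suc (i + j)) - 1 / sqrt (Suc (Suc (i + j)))))
      = 8 * moment_const * (1 / sqrt (Suc j))"
    by (intro sums_unique[symmetric] sums_mult sums_diff_inverse_sqrt)
  finally show ?thesis by simp
qed

text \<open>The power 5/2 of |1 - t z| splits as 3/2 + 1: the first part is bounded below by (1 -
  t)^(3/2), the second by (1 - t w) / 2 with w = 1 - |1 - z| / 2. The latter expands into a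
  geometric series in t w, so the integral becomes the series of w^j / sqrt (j + 1), of size 1 /
  sqrt (1 - w).\<close>

lemma nn_integral_kernel_le:
  fixes z :: complex
  assumes "norm z < 1"
  shows "(\<integral>\<^sup>+ t. ennreal (1 / sqrt (norm (1 - of_real t * z)) ^ 5) \<partial>\<mu>)
    \<le> ennreal (64 * moment_const / sqrt (norm (1 - z)))"
proof -
  define D where "D = norm (1 - z) / 2"
  define w where "w = 1 - D"
  have "norm (1 - z) \<le> 1 + norm z" "norm (1 - z) \<ge> 1 - norm z"
    using norm_triangle_ineq4[of 1 z] norm_triangle_ineq2[of 1 z] by simp_all
  then have D: "0 < D" "D \<le> 1" and w: "0 \<le> w" "w < 1"
    using assms by (auto simp: D_def w_def)
  have "(\<integral>\<^sup>+ t. ennreal (1 / sqrt (norm (1 - of_real t * z)) ^ 5) \<partial>\<mu>)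
      \<le> (\<integral>\<^sup>+ t. (\<Sum>j. ennreal (2 * w ^ j) * ennreal (t ^ j / sqrt (1 - t) ^ 3)) \<partial>\<mu>)"
  proof (rule nn_integral_mono)
    fix t assume "t \<in> space \<mu>"
    then have t: "0 \<le> t" "t < 1" by (auto simp: space_mu)
    define k where "k = norm (1 - of_real t * z)"
    have k1: "k \<ge> 1 - t" and k2: "k \<ge> D"
      using norm_one_minus_le_norm_one_minus_mult[of z t] assms t by (auto simp: k_def D_def)
    have "t * w \<le> t * 1" using t w by (intro mult_left_mono) auto
    then have tw: "0 \<le> t * w" "t * w < 1" using t w by simp_all
    have "t * D \<le> 1 * D" using t D by (intro mult_right_mono) auto
    \<comment> \<open>Here 1 - t w = (1 - t) + t D, a sum of two terms each at most
      \<open>k\<close>.\<close>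
    then have k3: "(1 - t * w) / 2 \<le> k"
      using k1 k2 by (simp add: w_def algebra_simps)
    have pos: "0 < k" using k2 D by linarith
    have "sqrt k ^ 5 = sqrt k ^ 3 * k"
      using pos by (simp add: power_numeral_reduce)
    moreover have "sqrt (1 - t) ^ 3 * ((1 - t * w) / 2) \<le> sqrt k ^ 3 * k"
      using t tw pos k1 k3 by (intro mult_mono power_mono) auto
    ultimately have "sqrt (1 - t) ^ 3 * ((1 - t * w) / 2) \<le> sqrt k ^ 5" by simp
    moreover have "0 < sqrt (1 - t) ^ 3 * ((1 - t * w) / 2)" using t tw by simp
    ultimately have "1 / sqrt k ^ 5 \<le> 1 / (sqrt (1 - t) ^ 3 * ((1 - t * w) / 2))"
      by (intro frac_le) auto
    also have "\<dots> = 2 / sqrt (1 - t) ^ 3 * (1 / (1 - t * w))" by simp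
    also have "1 / (1 - t * w) = (\<Sum>j. (t * w) ^ j)"
      using tw by (intro suminf_geometric[symmetric]) auto
    also have "2 / sqrt (1 - t) ^ 3 * (\<Sum>j. (t * w) ^ j) = (\<Sum>j. 2 / sqrt (1 - t) ^ 3 * (t * w) ^ j)"
      using tw by (intro suminf_mult[symmetric] summable_geometric) auto
    finally have "ennreal (1 / sqrt k ^ 5) \<le> ennreal (\<Sum>j. 2 / sqrt (1 - t) ^ 3 * (t * w) ^ j)"
      by (rule ennreal_leI)
    also have "\<dots> = (\<Sum>j. ennreal (2 / sqrt (1 - t) ^ 3 * (t * w) ^ j))"
      using t tw by (intro suminf_ennreal2[symmetric] summable_mult summable_geometric) auto
    also have "\<dots> = (\<Sum>j. ennreal (2 * w ^ j) * ennreal (t ^ j / sqrt (1 - t) ^ 3))"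
      using t w by (intro suminf_cong, subst ennreal_mult[symmetric])
        (auto simp: power_mult_distrib mult_ac)
    finally show "ennreal (1 / sqrt (norm (1 - of_real t * z)) ^ 5)
        \<le> (\<Sum>j. ennreal (2 * w ^ j) * ennreal (t ^ j / sqrt (1 - t) ^ 3))"
      by (simp add: k_def)
  qed
  also have "\<dots> = (\<Sum>j. ennreal (2 * w ^ j) * (\<integral>\<^sup>+ t. ennreal (t ^ j / sqrt (1 - t) ^ 3) \<partial>\<mu>))"
    by (subst nn_integral_suminf) (auto simp: nn_integral_cmult)
  also have "\<dots> \<le> (\<Sum>j. ennreal (2 * w ^ j) * ennreal (8 * moment_const / sqrt (Suc j)))"
    by (intro suminf_le mult_left_mono nn_integral_power_div_le) auto
  also have "\<dots> = (\<Sum>j. ennreal (16 * moment_const * (w ^ j / sqrt (Suc j))))"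
    using w moment_const_nonneg by (intro suminf_cong, subst ennreal_mult[symmetric]) (auto simp: mult_ac)
  also have "\<dots> = ennreal (\<Sum>j. 16 * moment_const * (w ^ j / sqrt (Suc j)))"
    using w moment_const_nonneg
    by (intro suminf_ennreal2 summable_mult summable_inverse_sqrt_series) auto
  also have "\<dots> \<le> ennreal (64 * moment_const / sqrt (norm (1 - z)))"
  proof (rule ennreal_leI)
    have "(\<Sum>j. 16 * moment_const * (w ^ j / sqrt (Suc j))) = 16 * moment_const * (\<Sum>j. w ^ j / sqrt (Suc j))"
      by (intro suminf_mult summable_inverse_sqrt_series w)
    also have "\<dots> \<le> 16 * moment_const * (2 / sqrt D)"
      using inverse_sqrt_series_le[OF w] moment_const_nonneg
      by (intro mult_left_mono) (auto simp: w_def)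
    also have "\<dots> \<le> 16 * moment_const * (4 / sqrt (norm (1 - z)))"
    proof (intro mult_left_mono)
      have "sqrt 2 \<le> (2::real)" by (rule real_le_lsqrt) auto
      then show "2 / sqrt D \<le> 4 / sqrt (norm (1 - z))"
        using D by (simp add: D_def real_sqrt_divide field_simps)
    qed (use moment_const_nonneg in auto)
    finally show "(\<Sum>j. 16 * moment_const * (w ^ j / sqrt (Suc j))) \<le> 64 * moment_const / sqrt (norm (1 - z))"
      by simp
  qed
  finally show ?thesis .
qed

text \<open>An embedding of H^2 into L^2 of the measure d\<mu> / (1 - t). The second Cauchy-Schwarz
  factor 2 / sqrt (1 - t) joins 1 / (1 - t) to form (1 - t)^(-3/2); the integral of t^k against that
  decays like 1 / sqrt (k + 1), which cancels the weight left on the coefficient.\<close>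

lemma nn_integral_power_series_le:
  fixes A :: "nat \<Rightarrow> complex"
  assumes A: "summable (\<lambda>k. norm (A k))"
  shows "(\<integral>\<^sup>+ t. ennreal ((norm (\<Sum>k. A k * of_real t ^ k))\<^sup>2 / (1 - t)) \<partial>\<mu>)
    \<le> ennreal (16 * moment_const * (\<Sum>k. (norm (A k))\<^sup>2))"
proof -
  have bnd: "norm (A k) \<le> (\<Sum>k. norm (A k))" for k
    using sum_le_suminf[OF A, of "{k}"] by simp
  note sm2 = summable_norm_square[OF A]
  have "(\<integral>\<^sup>+ t. ennreal ((norm (\<Sum>k. A k * of_real t ^ k))\<^sup>2 / (1 - t)) \<partial>\<mu>)
      \<le> (\<integral>\<^sup>+ t. (\<Sum>k. ennreal (2 * ((norm (A k))\<^sup>2 * sqrt (Suc k))) * ennreal (t ^ k / sqrt (1 - t) ^ 3)) \<partial>\<mu>)"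
  proof (rule nn_integral_mono)
    fix t assume "t \<in> space \<mu>"
    then have t: "0 \<le> t" "t < 1" by (auto simp: space_mu)
    have nt: "norm (A k * of_real t ^ k) = norm (A k) * t ^ k" for k
      using t by (simp add: norm_mult norm_power)
    have sA: "summable (\<lambda>k. norm (A k) * t ^ k)"
      by (rule summable_comparison_test'[OF A, of 0])
         (use t in \<open>auto intro!: mult_left_le power_le_one\<close>)
    define U where "U = (\<Sum>k. (norm (A k))\<^sup>2 * (sqrt (Suc k) * t ^ k))"
    have sU: "summable (\<lambda>k. (norm (A k))\<^sup>2 * (sqrt (Suc k) * t ^ k))"
      by (rule summable_comparison_test'[OF summable_mult[OF summable_sqrt_series[OF t], of "(\<Sum>k. norm (A k))\<^sup>2"], of 0])
         (use t bnd in \<open>auto intro!: mult_right_mono power_mono\<close>)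
    \<comment> \<open>Cauchy-Schwarz with weights \<open>sqrt (Suc k)\<close>, as in Schur's test for the Hilbert matrix.\<close>
    have fin: "(\<Sum>k<n. norm (A k) * t ^ k)\<^sup>2 \<le> U * (2 / sqrt (1 - t))" for n
    proof -
      have "(\<Sum>k<n. norm (A k) * t ^ k)
          = (\<Sum>k<n. (norm (A k) * sqrt (sqrt (Suc k) * t ^ k)) * sqrt (t ^ k / sqrt (Suc k)))"
      proof (intro sum.cong refl)
        fix k
        have "sqrt (sqrt (Suc k) * t ^ k) * sqrt (t ^ k / sqrt (Suc k))
            = sqrt ((sqrt (Suc k) * t ^ k) * (t ^ k / sqrt (Suc k)))"
          by (rule real_sqrt_mult[symmetric])
        also have "(sqrt (Suc k) * t ^ k) * (t ^ k / sqrt (Suc k)) = t ^ k * t ^ k"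
          by simp
        also have "sqrt (t ^ k * t ^ k) = t ^ k" using t by simp
        finally show "norm (A k) * t ^ k
            = (norm (A k) * sqrt (sqrt (Suc k) * t ^ k)) * sqrt (t ^ k / sqrt (Suc k))"
          by (simp only: mult.assoc)
      qed
      then have "(\<Sum>k<n. norm (A k) * t ^ k)\<^sup>2
          \<le> (\<Sum>k<n. (norm (A k) * sqrt (sqrt (Suc k) * t ^ k))\<^sup>2) * (\<Sum>k<n. (sqrt (t ^ k / sqrt (Suc k)))\<^sup>2)"
        by (simp only: Cauchy_Schwarz_ineq_sum)
      also have "(\<Sum>k<n. (norm (A k) * sqrt (sqrt (Suc k) * t ^ k))\<^sup>2)
          = (\<Sum>k<n. (norm (A k))\<^sup>2 * (sqrt (Suc k) * t ^ k))"
        using t by (intro sum.cong) (auto simp: power_mult_distrib)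
      also have "(\<Sum>k<n. (sqrt (t ^ k / sqrt (Suc k)))\<^sup>2) = (\<Sum>k<n. t ^ k / sqrt (Suc k))"
        using t by (intro sum.cong) auto
      also have "(\<Sum>k<n. (norm (A k))\<^sup>2 * (sqrt (Suc k) * t ^ k)) * (\<Sum>k<n. t ^ k / sqrt (Suc k))
          \<le> U * (\<Sum>k. t ^ k / sqrt (Suc k))"
        unfolding U_def using t
        by (intro mult_mono sum_le_suminf sU summable_inverse_sqrt_series suminf_nonneg sum_nonneg) auto
      also have "\<dots> \<le> U * (2 / sqrt (1 - t))"
        unfolding U_def using t
        by (intro mult_left_mono inverse_sqrt_series_le suminf_nonneg sU) auto
      finally show ?thesis .
    qed
    have "(\<Sum>k. norm (A k) * t ^ k)\<^sup>2 \<le> U * (2 / sqrt (1 - t))"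
      by (rule LIMSEQ_le_const2[OF tendsto_power[OF summable_LIMSEQ[OF sA]]]) (use fin in auto)
    moreover have "norm (\<Sum>k. A k * of_real t ^ k) \<le> (\<Sum>k. norm (A k) * t ^ k)"
      using summable_norm[of "\<lambda>k. A k * of_real t ^ k"] sA by (simp only: nt)
    ultimately have "(norm (\<Sum>k. A k * of_real t ^ k))\<^sup>2 \<le> U * (2 / sqrt (1 - t))"
      by (meson norm_ge_zero order_trans power_mono)
    then have "(norm (\<Sum>k. A k * of_real t ^ k))\<^sup>2 / (1 - t) \<le> U * (2 / sqrt (1 - t)) / (1 - t)"
      using t by (intro divide_right_mono) auto
    also have "\<dots> = 2 / sqrt (1 - t) ^ 3 * U"
      using t by (simp add: power3_eq_cube mult_ac)
    also have "\<dots> = (\<Sum>k. 2 / sqrt (1 - t) ^ 3 * ((norm (A k))\<^sup>2 * (sqrt (Suc k) * t ^ k)))"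
      unfolding U_def by (intro suminf_mult[symmetric] sU)
    finally have "ennreal ((norm (\<Sum>k. A k * of_real t ^ k))\<^sup>2 / (1 - t))
        \<le> ennreal (\<Sum>k. 2 / sqrt (1 - t) ^ 3 * ((norm (A k))\<^sup>2 * (sqrt (Suc k) * t ^ k)))"
      by (rule ennreal_leI)
    also have "\<dots> = (\<Sum>k. ennreal (2 / sqrt (1 - t) ^ 3 * ((norm (A k))\<^sup>2 * (sqrt (Suc k) * t ^ k))))"
      using t by (intro suminf_ennreal2[symmetric] summable_mult sU) auto
    also have "\<dots> = (\<Sum>k. ennreal (2 * ((norm (A k))\<^sup>2 * sqrt (Suc k))) * ennreal (t ^ k / sqrt (1 - t) ^ 3))"
      using t by (intro suminf_cong, subst ennreal_mult[symmetric]) (auto simp: mult_ac)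
    finally show "ennreal ((norm (\<Sum>k. A k * of_real t ^ k))\<^sup>2 / (1 - t))
        \<le> (\<Sum>k. ennreal (2 * ((norm (A k))\<^sup>2 * sqrt (Suc k))) * ennreal (t ^ k / sqrt (1 - t) ^ 3))" .
  qed
  also have "\<dots> = (\<Sum>k. ennreal (2 * ((norm (A k))\<^sup>2 * sqrt (Suc k))) * (\<integral>\<^sup>+ t. ennreal (t ^ k / sqrt (1 - t) ^ 3) \<partial>\<mu>))"
    by (subst nn_integral_suminf) (auto simp: nn_integral_cmult)
  also have "\<dots> \<le> (\<Sum>k. ennreal (2 * ((norm (A k))\<^sup>2 * sqrt (Suc k))) * ennreal (8 * moment_const / sqrt (Suc k)))"
    by (intro suminf_le mult_left_mono nn_integral_power_div_le) auto
  also have "\<dots> = (\<Sum>k. ennreal (16 * moment_const * (norm (A k))\<^sup>2))"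
    using moment_const_nonneg by (intro suminf_cong, subst ennreal_mult[symmetric]) (auto simp: mult_ac)
  also have "\<dots> = ennreal (\<Sum>k. 16 * moment_const * (norm (A k))\<^sup>2)"
    using moment_const_nonneg by (intro suminf_ennreal2 summable_mult sm2) auto
  also have "(\<Sum>k. 16 * moment_const * (norm (A k))\<^sup>2) = 16 * moment_const * (\<Sum>k. (norm (A k))\<^sup>2)"
    by (intro suminf_mult sm2)
  finally show ?thesis .
qed

end

section \<open>Power series on the circle and removal of zeros\<close>

lemma has_integral_suminf:
  fixes f :: "nat \<Rightarrow> real \<Rightarrow> complex"
  assumes f: "\<And>k. (f k has_integral I k) {a..b}"
    and cont: "\<And>k. continuous_on {a..b} (f k)"
    and M: "\<And>k x. x \<in> {a..b} \<Longrightarrow> norm (f k x) \<le> M k" "summable M"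
    and I: "I sums s"
  shows "((\<lambda>x. \<Sum>k. f k x) has_integral s) {a..b}"
proof -
  have "uniform_limit {a..b} (\<lambda>n x. \<Sum>k<n. f k x) (\<lambda>x. \<Sum>k. f k x) sequentially"
    by (rule Weierstrass_m_test[OF M])
  moreover have "\<And>n. continuous_on {a..b} (\<lambda>x. \<Sum>k<n. f k x)"
    by (intro continuous_on_sum cont)
  ultimately obtain J K where
    J: "\<And>n. ((\<lambda>x. \<Sum>k<n. f k x) has_integral J n) {a..b}"
    and K: "((\<lambda>x. \<Sum>k. f k x) has_integral K) {a..b}" "J \<longlonglongrightarrow> K"
    by (rule uniform_limit_integral) auto
  have "J = (\<lambda>n. \<Sum>k<n. I k)"
    by (intro ext has_integral_unique[OF J has_integral_sum]) (use f in auto)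
  then have "I sums K" using K(2) by (simp add: sums_def)
  then show ?thesis using K(1) I sums_unique2 by blast
qed

lemma has_integral_cis_int:
  "((\<lambda>\<theta>. cis (of_int m * \<theta>)) has_integral (if m = 0 then 2 * pi else 0)) {0..2 * pi}"
proof (cases "m = 0")
  case True
  then show ?thesis using has_integral_const_real[of "1::complex" 0 "2 * pi"]
    by (simp add: scaleR_conv_of_real)
next
  case False
  have "((\<lambda>\<theta>. cis (of_int m * \<theta>)) has_integral
      cis (of_int m * (2 * pi)) / (\<i> * of_int m) - cis (of_int m * 0) / (\<i> * of_int m)) {0..2 * pi}"
  proof (intro fundamental_theorem_of_calculus)
    fix x :: real
    have "((\<lambda>z. exp (\<i> * (of_int m * z)) / (\<i> * of_int m)) has_field_derivative exp (\<i> * (of_int m * of_real x))) (at (of_real x))"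
      by (rule derivative_eq_intros refl | simp add: False)+ (simp add: False field_simps)
    from has_vector_derivative_real_field[OF this]
    show "((\<lambda>\<theta>. cis (of_int m * \<theta>) / (\<i> * of_int m)) has_vector_derivative cis (of_int m * x)) (at x within {0..2 * pi})"
      by (simp add: cis_conv_exp)
  qed auto
  moreover have "cis (of_int m * (2 * pi)) = 1"
    using cis_multiple_2pi[of "of_int m"] by (simp add: mult_ac)
  ultimately show ?thesis using False by simp
qed

lemma norm_power_series_circle:
  fixes A :: "nat \<Rightarrow> complex"
  shows "norm (A k * cis \<theta> ^ k) = norm (A k)"
  by (simp add: norm_mult norm_power)

lemma continuous_on_power_series_circle:
  fixes A :: "nat \<Rightarrow> complex"
  assumes "summable (\<lambda>k. norm (A k))"
  shows "continuous_on S (\<lambda>\<theta>. \<Sum>k. A k * cis \<theta> ^ k)"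
proof (rule uniform_limit_theorem)
  show "uniform_limit S (\<lambda>n \<theta>. \<Sum>k<n. A k * cis \<theta> ^ k) (\<lambda>\<theta>. \<Sum>k. A k * cis \<theta> ^ k) sequentially"
    by (rule Weierstrass_m_test[OF _ assms]) (simp add: norm_power_series_circle)
  show "\<forall>\<^sub>F n in sequentially. continuous_on S (\<lambda>\<theta>. \<Sum>k<n. A k * cis \<theta> ^ k)"
    by (intro always_eventually allI continuous_intros)
qed auto

lemma coefficient_circle:
  fixes A :: "nat \<Rightarrow> complex"
  assumes "summable (\<lambda>k. norm (A k))"
  shows "((\<lambda>\<theta>. cis (- real k * \<theta>) * (\<Sum>j. A j * cis \<theta> ^ j)) has_integral 2 * pi * A k) {0..2 * pi}"
proof -
  have eq: "cis (- real k * \<theta>) * (A j * cis \<theta> ^ j) = A j * cis (of_int (int j - int k) * \<theta>)" for j \<theta>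
    by (simp add: Complex.DeMoivre cis_mult algebra_simps)
  have "((\<lambda>\<theta>. \<Sum>j. cis (- real k * \<theta>) * (A j * cis \<theta> ^ j)) has_integral 2 * pi * A k) {0..2 * pi}"
  proof (rule has_integral_suminf)
    show "((\<lambda>\<theta>. cis (- real k * \<theta>) * (A j * cis \<theta> ^ j)) has_integral
        A j * (if int j - int k = 0 then 2 * pi else 0)) {0..2 * pi}" for j
      unfolding eq using has_integral_mult_right[OF has_integral_cis_int[of "int j - int k"], of "A j"] by simp
    show "(\<lambda>j. A j * (if int j - int k = 0 then 2 * pi else 0)) sums (2 * pi * A k)"
    proof -
      have "(\<lambda>j. A j * (if int j - int k = 0 then 2 * pi else 0)) = (\<lambda>j. if j = k then A j * (2 * pi) else 0)"
        by auto
      then show ?thesis using sums_single[of k "\<lambda>j. A j * (2 * pi)"] by (simp add: mult_ac)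
    qed
    show "norm (cis (- real k * \<theta>) * (A j * cis \<theta> ^ j)) \<le> norm (A j)" for j \<theta>
      by (simp add: norm_mult norm_power)
    show "continuous_on {0..2 * pi} (\<lambda>\<theta>. cis (- real k * \<theta>) * (A j * cis \<theta> ^ j))" for j
      by (intro continuous_intros)
  qed (rule assms)
  moreover have "(\<Sum>j. cis (- real k * \<theta>) * (A j * cis \<theta> ^ j)) = cis (- real k * \<theta>) * (\<Sum>j. A j * cis \<theta> ^ j)" for \<theta>
    by (rule suminf_mult, rule summable_norm_cancel) (simp add: norm_power_series_circle assms)
  ultimately show ?thesis by simp
qed

text \<open>Only the conjugate factor is expanded into its series; each term integrates against the
  full sum to a coefficient by \<open>coefficient_circle\<close>, so no double series
  arises.\<close>

lemma parseval_circle: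
  fixes A :: "nat \<Rightarrow> complex"
  assumes A: "summable (\<lambda>k. norm (A k))"
  shows "((\<lambda>\<theta>. (norm (\<Sum>k. A k * cis \<theta> ^ k))\<^sup>2) has_integral 2 * pi * (\<Sum>k. (norm (A k))\<^sup>2)) {0..2 * pi}"
proof -
  define F where "F \<theta> = (\<Sum>k. A k * cis \<theta> ^ k)" for \<theta>
  have sF: "summable (\<lambda>k. A k * cis \<theta> ^ k)" for \<theta>
    by (rule summable_norm_cancel) (simp add: norm_power_series_circle A)
  have bF: "norm (F \<theta>) \<le> (\<Sum>k. norm (A k))" for \<theta>
    using summable_norm[of "\<lambda>k. A k * cis \<theta> ^ k"] A by (simp add: norm_power_series_circle F_def)
  note sm2 = summable_norm_square[OF A]
  have "((\<lambda>\<theta>. \<Sum>k. cnj (A k) * (cis (- real k * \<theta>) * F \<theta>)) has_integral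
      of_real (2 * pi * (\<Sum>k. (norm (A k))\<^sup>2))) {0..2 * pi}"
  proof (rule has_integral_suminf)
    show "((\<lambda>\<theta>. cnj (A k) * (cis (- real k * \<theta>) * F \<theta>)) has_integral of_real (2 * pi * (norm (A k))\<^sup>2)) {0..2 * pi}" for k
      using has_integral_mult_right[OF coefficient_circle[OF A, of k], of "cnj (A k)"]
      by (simp add: F_def complex_norm_square mult_ac del: of_real_power)
    show "(\<lambda>k. complex_of_real (2 * pi * (norm (A k))\<^sup>2)) sums of_real (2 * pi * (\<Sum>k. (norm (A k))\<^sup>2))"
      by (intro sums_of_real sums_mult summable_sums sm2)
    show "norm (cnj (A k) * (cis (- real k * \<theta>) * F \<theta>)) \<le> norm (A k) * (\<Sum>k. norm (A k))" for k \<theta>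
      using bF[of \<theta>] by (simp add: norm_mult mult_left_mono)
    show "summable (\<lambda>k. norm (A k) * (\<Sum>k. norm (A k)))"
      by (intro summable_mult2 A)
    show "continuous_on {0..2 * pi} (\<lambda>\<theta>. cnj (A k) * (cis (- real k * \<theta>) * F \<theta>))" for k
      unfolding F_def by (intro continuous_intros continuous_on_power_series_circle A)
  qed
  moreover have "(\<Sum>k. cnj (A k) * (cis (- real k * \<theta>) * F \<theta>)) = of_real ((norm (F \<theta>))\<^sup>2)" for \<theta>
  proof -
    have "(\<lambda>k. cnj (A k * cis \<theta> ^ k)) sums cnj (F \<theta>)"
      unfolding F_def by (intro sums_cnj[THEN iffD2] summable_sums sF)
    from sums_mult2[OF this, of "F \<theta>"]
    have "(\<lambda>k. cnj (A k) * (cis (- real k * \<theta>) * F \<theta>)) sums (cnj (F \<theta>) * F \<theta>)"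
      by (simp add: Complex.DeMoivre cis_cnj mult_ac)
    then show ?thesis by (simp add: sums_iff complex_norm_square mult_ac del: of_real_power)
  qed
  ultimately have "((\<lambda>\<theta>. complex_of_real ((norm (F \<theta>))\<^sup>2)) has_integral of_real (2 * pi * (\<Sum>k. (norm (A k))\<^sup>2))) {0..2 * pi}"
    by simp
  from has_integral_Re[OF this] show ?thesis by (simp add: F_def)
qed

section \<open>Zero-free majorants through Blaschke factors\<close>

lemma ball_superset_cball:
  fixes U :: "complex set"
  assumes "open U" "cball 0 1 \<subseteq> U"
  obtains R where "R > 1" "ball 0 R \<subseteq> U"
proof -
  obtain e where e: "e > 0" "(\<Union>x\<in>cball 0 1. ball x e) \<subseteq> U"
    using compact_subset_open_imp_ball_epsilon_subset[OF compact_cball assms] by auto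
  have "ball 0 (1 + e) \<subseteq> U"
  proof
    fix z :: complex assume z: "z \<in> ball 0 (1 + e)"
    \<comment> \<open>The point of the closed disc nearest to \<open>z\<close>.\<close>
    define x where "x = (if norm z \<le> 1 then z else sgn z)"
    have "norm (sgn z - z) = norm z - 1" if "norm z > 1"
    proof -
      have "sgn z - z = of_real (1 / norm z - 1) * z"
        by (simp add: sgn_eq left_diff_distrib)
      then have "norm (sgn z - z) = \<bar>1 / norm z - 1\<bar> * norm z"
        by (simp only: norm_mult norm_of_real)
      also have "\<bar>1 / norm z - 1\<bar> = 1 - 1 / norm z"
      proof -
        have "1 / norm z \<le> 1" using that by (simp add: divide_le_eq)
        then show ?thesis by simp
      qed
      also have "\<dots> * norm z = norm z - 1"
      proof -
        have "z \<noteq> 0" using that by auto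
        then show ?thesis by (simp add: left_diff_distrib)
      qed
      finally show ?thesis .
    qed
    then have "x \<in> cball 0 1" "z \<in> ball x e"
      using z e(1) by (auto simp: x_def norm_sgn dist_norm)
    then show "z \<in> U" using e(2) by blast
  qed
  then show ?thesis using that[of "1 + e"] e(1) by simp
qed

text \<open>A Blaschke factor is bounded by 1 on the disc, here freed from its denominator; the
  difference of the squared norms factors into two nonnegative terms.\<close>

lemma norm_diff_le_norm_one_minus_cnj:
  fixes z a :: complex
  assumes "norm z \<le> 1" "norm a \<le> 1"
  shows "norm (z - a) \<le> norm (1 - cnj a * z)"
proof -
  have "(norm (1 - cnj a * z))\<^sup>2 - (norm (z - a))\<^sup>2 = (1 - (norm z)\<^sup>2) * (1 - (norm a)\<^sup>2)"
    unfolding cmod_power2 by (simp add: power2_eq_square algebra_simps)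
  moreover have "0 \<le> (1 - (norm z)\<^sup>2) * (1 - (norm a)\<^sup>2)"
    using assms by (intro mult_nonneg_nonneg) (auto simp: power_le_one)
  ultimately have "(norm (z - a))\<^sup>2 \<le> (norm (1 - cnj a * z))\<^sup>2" by linarith
  then show ?thesis by (rule power2_le_imp_le) simp
qed

lemma norm_diff_eq_norm_one_minus_cnj:
  fixes z a :: complex
  assumes "norm z = 1"
  shows "norm (z - a) = norm (1 - cnj a * z)"
proof -
  have "(norm (1 - cnj a * z))\<^sup>2 - (norm (z - a))\<^sup>2 = (1 - (norm z)\<^sup>2) * (1 - (norm a)\<^sup>2)"
    unfolding cmod_power2 by (simp add: power2_eq_square algebra_simps)
  then have "(norm (z - a))\<^sup>2 = (norm (1 - cnj a * z))\<^sup>2" by (simp add: assms)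
  then show ?thesis by (rule power2_eq_imp_eq) auto
qed

text \<open>With no zero on the circle, the zeros in the closed disc are finite in number and lie
  inside. They are divided out and replaced by the factors 1 - cnj a z, whose zeros lie outside the
  closed disc and which have the same modulus on the circle. That \<open>g\<close> is zero-free on a
  larger disc provides a logarithm beyond the circle.\<close>

lemma zero_free_majorant:
  assumes f: "f holomorphic_on ball 0 \<rho>" "\<rho> > 1" and nz: "\<And>z. norm z = 1 \<Longrightarrow> f z \<noteq> 0"
  obtains g R where "R > 1" "g holomorphic_on ball 0 R" "\<And>z. z \<in> ball 0 R \<Longrightarrow> g z \<noteq> 0"
    "\<And>z. norm z = 1 \<Longrightarrow> norm (g z) = norm (f z)" "\<And>z. norm z < 1 \<Longrightarrow> norm (f z) \<le> norm (g z)"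
proof -
  \<comment> \<open>A disc inside \<open>U\<close> contains no zero of \<open>f\<close> other than
    those in the open unit disc.\<close>
  define U where "U = (ball 0 \<rho> \<inter> f -` (- {0})) \<union> ball 0 1"
  have "open U" unfolding U_def
    by (intro open_Un continuous_open_preimage holomorphic_on_imp_continuous_on f) auto
  moreover have "cball 0 1 \<subseteq> U" using f(2) nz unfolding U_def
    by (auto simp: less_eq_real_def)
  ultimately obtain R where R: "R > 1" "ball 0 R \<subseteq> U" by (rule ball_superset_cball)
  have "U \<subseteq> ball 0 \<rho>" using f(2) by (auto simp: U_def)
  with R(2) have R\<rho>: "ball (0::complex) R \<subseteq> ball 0 \<rho>" by (rule subset_trans)
  have holf: "f holomorphic_on ball 0 R" by (rule holomorphic_on_subset[OF f(1) R\<rho>])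
  define Z where "Z = {z \<in> cball 0 1. f z = 0}"
  have Z: "z \<in> Z \<longleftrightarrow> f z = 0" if "z \<in> ball 0 R" for z
    using that R(2) by (auto simp: Z_def U_def)
  have Z1: "norm a < 1" if "a \<in> Z" for a
  proof -
    have "norm a \<le> 1" "f a = 0" using that by (auto simp: Z_def)
    moreover have "norm a \<noteq> 1" using nz[of a] \<open>f a = 0\<close> by blast
    ultimately show ?thesis by simp
  qed
  have finZ: "finite Z"
  proof (cases "f constant_on ball 0 R")
    case True
    then obtain c where c: "\<And>z. z \<in> ball 0 R \<Longrightarrow> f z = c" unfolding constant_on_def by blast
    have "c \<noteq> 0" using c[of 1] nz[of 1] R(1) by simp
    have "z \<notin> Z" for z
      using c[of z] \<open>c \<noteq> 0\<close> R(1) by (auto simp: Z_def)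
    then have "Z = {}" by blast
    then show ?thesis by simp
  next
    case False
    then show ?thesis unfolding Z_def using R(1)
      by (intro holomorphic_compact_finite_zeros[OF holf]) auto
  qed
  have f1: "(1::complex) \<in> ball 0 R" "f 1 \<noteq> 0" using R(1) nz[of 1] by auto
  \<comment> \<open>At a zero of \<open>f\<close> the order is positive, so the conversion to nat
    loses nothing.\<close>
  define n where "n a = nat (zorder f a)" for a
  have n_pos: "zorder f a = int (n a)" "n a > 0" if "a \<in> Z" for a
  proof -
    have a: "a \<in> ball 0 R" "f a = 0" using that R(1) by (auto simp: Z_def)
    have "\<exists>w\<in>ball 0 R. f w \<noteq> 0" using f1 by blast
    from zorder_exist_zero[OF holf open_ball connected_ball a(1) this]
    have "zorder f a > 0" using a(2) by simp
    then show "zorder f a = int (n a)" "n a > 0" by (simp_all add: n_def)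
  qed
  define P where "P z = (\<Prod>a\<in>Z. (z - a) ^ n a)" for z
  have P0: "P z = 0 \<longleftrightarrow> z \<in> Z" for z
  proof -
    have "P z = 0 \<longleftrightarrow> (\<exists>a\<in>Z. (z - a) ^ n a = 0)"
      unfolding P_def by (rule prod_zero_iff[OF finZ])
    also have "\<dots> \<longleftrightarrow> (\<exists>a\<in>Z. z = a)"
    proof (intro bex_cong refl)
      show "(z - a) ^ n a = 0 \<longleftrightarrow> z = a" if "a \<in> Z" for a
        using n_pos(2)[OF that] by simp
    qed
    finally show ?thesis by simp
  qed
  have holP: "P holomorphic_on A" for A unfolding P_def by (intro holomorphic_intros)
  \<comment> \<open>Equality of orders at every point of the disc removes the singularities of f / P
    and leaves a zero-free quotient.\<close>
  have ord: "zorder P z = zorder f z" if z: "z \<in> ball 0 R" for z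
  proof -
    have "eventually (\<lambda>w. w \<notin> Z) (at z)"
      using islimpt_finite[OF finZ, of z] unfolding islimpt_iff_eventually by blast
    then have ev: "eventually (\<lambda>w. P w \<noteq> 0) (at z)" by (simp add: P0)
    have "zorder P z = (\<Sum>a\<in>Z. zorder (\<lambda>z. (z - a) ^ n a) z)"
      unfolding P_def
    proof (rule zorder_prod_analytic)
      show "eventually (\<lambda>z. (\<Prod>a\<in>Z. (z - a) ^ n a) \<noteq> 0) (at z)" using ev unfolding P_def .
    qed (intro analytic_intros)
    also have "\<dots> = (\<Sum>a\<in>Z. if a = z then int (n a) else 0)"
    proof (intro sum.cong refl)
      fix a assume "a \<in> Z"
      show "zorder (\<lambda>z. (z - a) ^ n a) z = (if a = z then int (n a) else 0)"
      proof (cases "a = z")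
        case True
        have "zorder (\<lambda>z. (z - a) ^ n a) a = int (n a)"
          by (rule zorder_eqI[where S = UNIV and g = "\<lambda>_. 1"]) auto
        then show ?thesis using True by simp
      next
        case False
        have "zorder (\<lambda>z. (z - a) ^ n a) z = 0"
          by (rule zorder_eq_0I) (use False in \<open>auto intro!: analytic_intros\<close>)
        then show ?thesis using False by simp
      qed
    qed
    also have "\<dots> = (if z \<in> Z then int (n z) else 0)" using finZ by simp
    also have "\<dots> = zorder f z"
    proof (cases "z \<in> Z")
      case False
      then have "zorder f z = 0" using z holf Z[OF z]
        by (intro zorder_eq_0I) (use analytic_at open_ball in blast, simp)
      then show ?thesis using False by simp
    qed (simp add: n_pos)
    finally show ?thesis .
  qed
  obtain h where h: "h holomorphic_on ball 0 R" "\<And>z. z \<in> ball 0 R \<Longrightarrow> h z \<noteq> 0"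
    "\<And>z. z \<in> ball 0 R \<Longrightarrow> f z = h z * P z"
  proof (rule holomorphic_zorder_factorization[of f "ball 0 R" P])
    show "P z = 0 \<longleftrightarrow> f z = 0" if "z \<in> ball 0 R" for z using Z[OF that] P0 by simp
  qed (use holf holP ord in auto)
  \<comment> \<open>The quotient \<open>P / Q\<close> is the finite Blaschke product of the zeros of \<open>f\<close>.\<close>
  define Q where "Q z = (\<Prod>a\<in>Z. (1 - cnj a * z) ^ n a)" for z
  define g where "g z = h z * Q z" for z
  have holg: "g holomorphic_on ball 0 R"
    unfolding g_def Q_def by (intro holomorphic_intros h)
  have Q0: "Q z \<noteq> 0" if "norm z \<le> 1" for z
  proof -
    have "cnj a * z \<noteq> 1" if "a \<in> Z" for a
    proof
      assume "cnj a * z = 1"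
      then have "norm a * norm z = 1" by (metis complex_mod_cnj norm_mult norm_one)
      moreover have "norm a * norm z \<le> norm a" using \<open>norm z \<le> 1\<close> by (simp add: mult_left_le)
      ultimately show False using Z1[OF \<open>a \<in> Z\<close>] by linarith
    qed
    then show ?thesis using finZ by (auto simp: Q_def)
  qed
  \<comment> \<open>\<open>Q\<close> may vanish in \<open>ball 0 R\<close> outside the closed unit
    disc, so the disc shrinks once more.\<close>
  have "open (ball 0 R \<inter> g -` (- {0}))"
    by (intro continuous_open_preimage holomorphic_on_imp_continuous_on holg) auto
  moreover have "cball 0 1 \<subseteq> ball 0 R \<inter> g -` (- {0})"
    using R(1) Q0 h(2) by (auto simp: g_def)
  ultimately obtain R' where R': "R' > 1" "ball 0 R' \<subseteq> ball 0 R \<inter> g -` (- {0})"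
    by (rule ball_superset_cball)
  show ?thesis
  proof (rule that[OF R'(1)])
    show "g holomorphic_on ball 0 R'" by (rule holomorphic_on_subset[OF holg]) (use R'(2) in blast)
    show "g z \<noteq> 0" if "z \<in> ball 0 R'" for z using R'(2) that by blast
    show "norm (g z) = norm (f z)" if "norm z = 1" for z
    proof -
      have "norm (P z) = norm (Q z)"
        unfolding P_def Q_def prod_norm[symmetric] norm_power
        by (intro prod.cong refl arg_cong[where f = "\<lambda>x. x ^ _"] norm_diff_eq_norm_one_minus_cnj that)
      then show ?thesis
        using that R(1) h(3)[of z] by (simp add: g_def norm_mult)
    qed
    show "norm (f z) \<le> norm (g z)" if "norm z < 1" for z
    proof -
      have "norm (P z) \<le> norm (Q z)"
        unfolding P_def Q_def prod_norm[symmetric] norm_power using that Z1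
        by (intro prod_mono conjI power_mono norm_diff_le_norm_one_minus_cnj) (auto simp: less_imp_le)
      then show ?thesis
        using that R(1) h(3)[of z] by (simp add: g_def norm_mult mult_left_mono)
    qed
  qed
qed

text \<open>The zero-free \<open>g\<close> has a logarithm \<open>L\<close>, and the square of |exp
  (p L / 2)| is |g|^p, so p-th powers become squares, which Parseval's identity handles in
  coefficients. Holomorphy past the circle makes these coefficients absolutely summable.\<close>

lemma powr_majorant_power_series:
  assumes f: "f holomorphic_on ball 0 \<rho>" "\<rho> > 1" and nz: "\<And>z. norm z = 1 \<Longrightarrow> f z \<noteq> 0"
  obtains A :: "nat \<Rightarrow> complex" where "summable (\<lambda>k. norm (A k))"
    "\<And>z. norm z = 1 \<Longrightarrow> (norm (\<Sum>k. A k * z ^ k))\<^sup>2 = norm (f z) powr p"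
    "\<And>z. norm z < 1 \<Longrightarrow> p > 0 \<Longrightarrow> norm (f z) powr p \<le> (norm (\<Sum>k. A k * z ^ k))\<^sup>2"
proof -
  obtain g R where g: "R > 1" "g holomorphic_on ball 0 R" "\<And>z. z \<in> ball 0 R \<Longrightarrow> g z \<noteq> 0"
    "\<And>z. norm z = 1 \<Longrightarrow> norm (g z) = norm (f z)" "\<And>z. norm z < 1 \<Longrightarrow> norm (f z) \<le> norm (g z)"
    using zero_free_majorant[OF f nz] by metis
  have "0 \<in> ball (0::complex) R" using g(1) by simp
  then obtain L where L: "L holomorphic_on ball 0 R" "\<And>z. z \<in> ball 0 R \<Longrightarrow> exp (L z) = g z"
    using holomorphic_logarithm_exists[OF convex_ball open_ball g(2,3)] by metis
  define F where "F z = exp (of_real (p / 2) * L z)" for z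
  have holF: "F holomorphic_on ball 0 R" unfolding F_def by (intro holomorphic_intros L)
  define A where "A k = (deriv ^^ k) F 0 / fact k" for k
  have sums: "(\<lambda>k. A k * z ^ k) sums F z" if "z \<in> ball 0 R" for z
    using holomorphic_power_series[OF holF that] by (simp add: A_def)
  define r where "r = (1 + R) / 2"
  have r: "1 < r" "r < R" using g(1) by (auto simp: r_def)
  have "summable (\<lambda>k. A k * of_real r ^ k)"
    using sums[of "of_real r"] r by (auto simp: sums_iff)
  then have sm: "summable (\<lambda>k. norm (A k))"
    using powser_insidea[of A "of_real r" 1] r by simp
  have F: "(\<Sum>k. A k * z ^ k) = F z" if "norm z \<le> 1" for z
    using sums[of z] that g(1) by (simp add: sums_iff)
  have nF: "(norm (F z))\<^sup>2 = norm (g z) powr p" if "norm z \<le> 1" for z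
  proof -
    have z: "z \<in> ball 0 R" using that g(1) by simp
    have "(norm (F z))\<^sup>2 = exp (p * Re (L z))"
      by (simp add: F_def flip: exp_double)
    also have "\<dots> = norm (g z) powr p"
      unfolding L(2)[OF z, symmetric] by (simp add: exp_powr_real mult_ac)
    finally show ?thesis .
  qed
  show ?thesis
    by (rule that[OF sm]) (use F nF g(4,5) in \<open>auto intro!: powr_mono2\<close>)
qed

section \<open>Kernel estimates and Jensen's inequality\<close>

lemma sin_ge_half:
  assumes "0 \<le> x" "x \<le> pi / 2"
  shows "x / 2 \<le> sin x"
proof -
  have conc: "concave_on {0..pi} (sin :: real \<Rightarrow> real)"
    by (rule f''_le0_imp_concave[where f' = cos and f'' = "\<lambda>x. - sin x"])
       (auto intro!: derivative_eq_intros sin_ge_zero)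
  define u where "u = 2 * x / pi"
  have u: "0 \<le> u" "u \<le> 1" using assms by (auto simp: u_def field_simps)
  have "(1 - u) * sin 0 + u * sin (pi / 2) \<le> sin ((1 - u) *\<^sub>R 0 + u *\<^sub>R (pi / 2))"
    by (rule concave_onD[OF conc u]) auto
  then have "u \<le> sin x" by (simp add: u_def)
  \<comment> \<open>Concavity gives the constant 2 / pi; weakening it to 1/2 keeps the later
    constants rational.\<close>
  moreover have "x / 2 \<le> u"
    using mult_right_mono[OF pi_less_4[THEN less_imp_le] assms(1)] by (simp add: u_def field_simps)
  ultimately show ?thesis by linarith
qed

lemma norm_one_minus_cis_ge:
  assumes "0 \<le> \<theta>" "\<theta> \<le> 2 * pi"
  shows "min \<theta> (2 * pi - \<theta>) / 2 \<le> norm (1 - cis \<theta>)"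
proof -
  have n: "norm (1 - cis \<theta>) = 2 * \<bar>sin (\<theta> / 2)\<bar>"
    using dist_exp_i_1[of \<theta>] by (simp add: cis_conv_exp norm_minus_commute)
  show ?thesis
  proof (cases "\<theta> \<le> pi")
    case True
    then have "\<theta> / 2 / 2 \<le> sin (\<theta> / 2)" using assms by (intro sin_ge_half) auto
    then show ?thesis unfolding n using True by (simp add: min_def)
  next
    case False
    have "(pi - \<theta> / 2) / 2 \<le> sin (pi - \<theta> / 2)" using assms False by (intro sin_ge_half) auto
    then show ?thesis unfolding n using False by (simp add: min_def)
  qed
qed

text \<open>\<open>\<psi>\<close> has the antiderivative (2 / x) sqrt (\<theta> / (x + \<theta>)),
  which is bounded by 2 / x. The kernel peaks at both ends of the interval; adding the reflected
  copy dominates \<open>\<psi>\<close> of the distance to the nearer end.\<close>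

lemma has_integral_sqrt_kernel:
  fixes x :: real
  assumes "x > 0" and \<psi>_def: "\<And>\<theta>. \<psi> \<theta> = 1 / (sqrt \<theta> * sqrt (x + \<theta>) ^ 3)"
  obtains I where "I \<le> 4 / x" "((\<lambda>\<theta>. \<psi> \<theta> + \<psi> (2 * pi - \<theta>)) has_integral I) {0..2 * pi}"
proof -
  define F where "F \<theta> = 2 / x * sqrt (\<theta> / (x + \<theta>))" for \<theta>
  have der: "(F has_real_derivative \<psi> \<theta>) (at \<theta>)" if "\<theta> > 0" for \<theta>
  proof -
    have "(F has_real_derivative 2 / x * (inverse (sqrt (\<theta> / (x + \<theta>))) / 2 * ((1 * (x + \<theta>) - \<theta> * 1) / ((x + \<theta>) * (x + \<theta>))))) (at \<theta>)"
      unfolding F_def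
    proof (rule DERIV_cmult[OF DERIV_chain2[OF DERIV_real_sqrt]])
      show "((\<lambda>\<theta>. \<theta> / (x + \<theta>)) has_real_derivative (1 * (x + \<theta>) - \<theta> * 1) / ((x + \<theta>) * (x + \<theta>))) (at \<theta>)"
        using that assms(1) by (auto intro!: derivative_eq_intros)
    qed (use that assms(1) in auto)
    moreover have "2 / x * (inverse (sqrt (\<theta> / (x + \<theta>))) / 2 * ((1 * (x + \<theta>) - \<theta> * 1) / ((x + \<theta>) * (x + \<theta>)))) = \<psi> \<theta>"
    proof -
      define a b where "a = sqrt \<theta>" and "b = sqrt (x + \<theta>)"
      have ab: "a > 0" "b > 0" "x + \<theta> = b\<^sup>2" using that assms(1) by (auto simp: a_def b_def)
      have "sqrt (\<theta> / (x + \<theta>)) = a / b" "1 * (x + \<theta>) - \<theta> * 1 = x"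
        by (simp_all add: a_def b_def real_sqrt_divide)
      moreover have "(x + \<theta>) * (x + \<theta>) = b\<^sup>2 * b\<^sup>2" by (simp only: ab(3))
      ultimately have "2 / x * (inverse (sqrt (\<theta> / (x + \<theta>))) / 2 * ((1 * (x + \<theta>) - \<theta> * 1) / ((x + \<theta>) * (x + \<theta>))))
          = 2 / x * (b / a / 2 * (x / (b\<^sup>2 * b\<^sup>2)))"
        by (simp only: inverse_divide)
      also have "\<dots> = 1 / (a * b ^ 3)"
        using ab(1,2) assms(1) by (simp add: field_simps power2_eq_square power3_eq_cube)
      finally show ?thesis by (simp add: \<psi>_def a_def b_def)
    qed
    ultimately show ?thesis by simp
  qed
  have F: "0 \<le> F \<theta>" "F \<theta> \<le> 2 / x" if "0 \<le> \<theta>" for \<theta>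
  proof -
    have "sqrt (\<theta> / (x + \<theta>)) \<le> 1" using that assms(1) by simp
    then show "0 \<le> F \<theta>" "F \<theta> \<le> 2 / x"
      using that assms(1) mult_left_mono[of "sqrt (\<theta> / (x + \<theta>))" 1 "2 / x"]
      by (auto simp: F_def)
  qed
  \<comment> \<open>At the endpoints the antiderivative is continuous but not differentiable, so
    derivatives are taken in the interior only.\<close>
  have "((\<lambda>\<theta>. \<psi> \<theta> + \<psi> (2 * pi - \<theta>)) has_integral
      (F (2 * pi) - F (2 * pi - 2 * pi)) - (F 0 - F (2 * pi - 0))) {0..2 * pi}"
  proof (rule fundamental_theorem_of_calculus_interior)
    have c: "continuous_on {0..} F" unfolding F_def
      using assms(1) by (intro continuous_intros) auto
    show "continuous_on {0..2 * pi} (\<lambda>\<theta>. F \<theta> - F (2 * pi - \<theta>))"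
      by (intro continuous_on_diff continuous_on_compose2[OF c] continuous_intros) auto
    fix \<theta> assume "\<theta> \<in> {0<..<2 * pi}"
    then have \<theta>: "\<theta> > 0" "2 * pi - \<theta> > 0" by auto
    have "((\<lambda>\<theta>. F (2 * pi - \<theta>)) has_real_derivative \<psi> (2 * pi - \<theta>) * (0 - 1)) (at \<theta>)"
      by (rule DERIV_chain2[where f = F and g = "\<lambda>\<theta>. 2 * pi - \<theta>", OF der[OF \<theta>(2)]]) (auto intro!: derivative_eq_intros)
    from DERIV_diff[OF der[OF \<theta>(1)] this]
    show "((\<lambda>\<theta>. F \<theta> - F (2 * pi - \<theta>)) has_vector_derivative \<psi> \<theta> + \<psi> (2 * pi - \<theta>)) (at \<theta>)"
      by (simp add: has_real_derivative_iff_has_vector_derivative)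
  qed auto
  moreover have "(F (2 * pi) - F (2 * pi - 2 * pi)) - (F 0 - F (2 * pi - 0)) \<le> 4 / x"
    using F[of 0] F[of "2 * pi"] by simp
  ultimately show ?thesis using that by blast
qed

lemma nn_integral_angular_kernel_le:
  assumes t: "0 \<le> t" "t < 1" and r: "0 \<le> r" "r \<le> 1"
  shows "(\<integral>\<^sup>+ \<theta>. ennreal (1 / (sqrt (norm (1 - of_real r * cis \<theta>))
      * sqrt (norm (1 - of_real t * (of_real r * cis \<theta>))) ^ 3)) * indicator {0..2 * pi} \<theta> \<partial>lborel)
    \<le> ennreal (120 / (1 - t))"
proof -
  define x where "x = 1 - t"
  have x: "x > 0" using t by (simp add: x_def)
  define \<psi> where "\<psi> \<theta> = 1 / (sqrt \<theta> * sqrt (x + \<theta>) ^ 3)" for \<theta>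
  obtain I where I: "I \<le> 4 / x" "((\<lambda>\<theta>. \<psi> \<theta> + \<psi> (2 * pi - \<theta>)) has_integral I) {0..2 * pi}"
    by (rule has_integral_sqrt_kernel[OF x \<psi>_def])
  have \<psi>_nonneg: "0 \<le> \<psi> \<theta>" if "\<theta> \<ge> 0" for \<theta> using that x by (simp add: \<psi>_def)
  define k where "k \<theta> = 1 / (sqrt (norm (1 - of_real r * cis \<theta>))
      * sqrt (norm (1 - of_real t * (of_real r * cis \<theta>))) ^ 3)" for \<theta>
  have bound: "k \<theta> \<le> 30 * (\<psi> \<theta> + \<psi> (2 * pi - \<theta>))" if \<theta>: "0 < \<theta>" "\<theta> < 2 * pi" for \<theta>
  proof -
    define m where "m = min \<theta> (2 * pi - \<theta>)"
    have m: "m > 0" using \<theta> by (simp add: m_def)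
    have d: "m / 2 \<le> norm (1 - cis \<theta>)"
      using norm_one_minus_cis_ge[of \<theta>] \<theta> by (simp add: m_def)
    have d1: "m / 4 \<le> norm (1 - of_real r * cis \<theta>)"
      using d norm_one_minus_le_norm_one_minus_mult(2)[of "cis \<theta>" r] r by simp
    \<comment> \<open>With \<open>N\<close> for the norm, N \<ge> 1 - t = x and 4 N \<ge> m, hence x
      + m \<le> 6 N.\<close>
    have d2: "(x + m) / 6 \<le> norm (1 - of_real t * (of_real r * cis \<theta>))"
    proof -
      have tr: "0 \<le> t * r" "t * r \<le> t" using t r by (auto intro: mult_left_le)
      have "1 - t * r \<le> norm (1 - of_real (t * r) * cis \<theta>)"
           "norm (1 - cis \<theta>) \<le> 2 * norm (1 - of_real (t * r) * cis \<theta>)"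
        using norm_one_minus_le_norm_one_minus_mult[of "cis \<theta>" "t * r"] tr t by auto
      moreover have "(x + m) / 6 \<le> N" if "1 - t * r \<le> N" "A \<le> 2 * N" "m / 2 \<le> A" for N A
        using that tr t unfolding x_def by (simp add: field_simps)
      ultimately have "(x + m) / 6 \<le> norm (1 - of_real (t * r) * cis \<theta>)"
        using d by blast
      then show ?thesis by (simp add: mult.assoc)
    qed
    have "sqrt (m / 4) * sqrt ((x + m) / 6) ^ 3 \<le> sqrt (norm (1 - of_real r * cis \<theta>))
      * sqrt (norm (1 - of_real t * (of_real r * cis \<theta>))) ^ 3"
      using d1 d2 m x by (intro mult_mono power_mono) auto
    moreover have "sqrt m * sqrt (x + m) ^ 3 / 30 \<le> sqrt (m / 4) * sqrt ((x + m) / 6) ^ 3"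
    proof -
      \<comment> \<open>After squaring this is 216 \<le> 225. The root of m / 4 contributes another
        factor 2, which makes the constant 30.\<close>
      have "sqrt 6 ^ 3 \<le> (15::real)"
      proof (rule power2_le_imp_le)
        have "(sqrt 6 ^ 3)\<^sup>2 = ((sqrt 6)\<^sup>2) ^ 3" by (simp only: power_mult[symmetric] mult.commute)
        then show "(sqrt 6 ^ 3)\<^sup>2 \<le> (15::real)\<^sup>2" by simp
      qed simp
      then have "2 * sqrt 6 ^ 3 \<le> (30::real)" by simp
      then have "sqrt m * sqrt (x + m) ^ 3 / 30 \<le> sqrt m * sqrt (x + m) ^ 3 / (2 * sqrt 6 ^ 3)"
        using m x by (intro divide_left_mono) auto
      then show ?thesis by (simp add: real_sqrt_divide power_divide)
    qed
    moreover have "0 < sqrt m * sqrt (x + m) ^ 3 / 30" using m x by simp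
    ultimately have "k \<theta> \<le> 1 / (sqrt m * sqrt (x + m) ^ 3 / 30)"
      unfolding k_def by (intro frac_le) auto
    also have "\<dots> = 30 * \<psi> m" by (simp add: \<psi>_def)
    also have "\<dots> \<le> 30 * (\<psi> \<theta> + \<psi> (2 * pi - \<theta>))"
      using \<psi>_nonneg[of \<theta>] \<psi>_nonneg[of "2 * pi - \<theta>"] \<theta> by (auto simp: m_def min_def)
    finally show ?thesis .
  qed
  have "(\<integral>\<^sup>+ \<theta>. ennreal (k \<theta>) * indicator {0..2 * pi} \<theta> \<partial>lborel)
      \<le> (\<integral>\<^sup>+ \<theta>. ennreal (30 * (\<psi> \<theta> + \<psi> (2 * pi - \<theta>))) * indicator {0..2 * pi} \<theta> \<partial>lborel)"
  proof (rule nn_integral_mono_AE)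
    \<comment> \<open>At the endpoints division by zero makes one value of \<open>\<psi>\<close>
      vanish, so \<open>bound\<close> can fail there.\<close>
    have "AE \<theta> in lborel. \<theta> \<noteq> 0 \<and> \<theta> \<noteq> 2 * pi"
      using AE_lborel_singleton[of "0::real"] AE_lborel_singleton[of "2 * pi"] by eventually_elim simp
    then show "AE \<theta> in lborel. ennreal (k \<theta>) * indicator {0..2 * pi} \<theta>
        \<le> ennreal (30 * (\<psi> \<theta> + \<psi> (2 * pi - \<theta>))) * indicator {0..2 * pi} \<theta>"
    proof eventually_elim
      case (elim \<theta>)
      then show ?case using bound[of \<theta>] by (auto simp: indicator_def intro!: ennreal_leI)
    qed
  qed
  also have "\<dots> = ennreal (30 * I)"
    by (rule nn_integral_has_integral_lebesgue'[OF _ has_integral_mult_right[OF I(2)]])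
       (use \<psi>_nonneg in auto)
  also have "\<dots> \<le> ennreal (120 / (1 - t))"
    using I(1) by (intro ennreal_leI) (simp add: x_def)
  finally show ?thesis by (simp add: k_def)
qed

section \<open>Jensen's inequality for powers with an unnormalised weight\<close>

lemma powr_tangent_le:
  fixes u y p :: real
  assumes "p \<ge> 1" "u \<ge> 0" "y > 0"
  shows "y powr p + p * y powr (p - 1) * (u - y) \<le> u powr p"
proof (cases "u = 0")
  case True
  have "y powr p = y powr (p - 1) * y"
    using assms(3) by (simp add: powr_diff)
  then have "y powr p + p * y powr (p - 1) * (u - y) = (1 - p) * y powr p"
    using True by (simp add: algebra_simps)
  then show ?thesis using True assms(1) by (simp add: mult_nonpos_nonneg)
next
  case False
  define s where "s = u / y"
  have s: "s > 0" using False assms by (simp add: s_def)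
  \<comment> \<open>Young's inequality for \<open>s powr p\<close> and 1 amounts to Bernoulli's
    inequality 1 + p (s - 1) \<le> s^p, the tangent at 1; homogeneity moves it to
    \<open>y\<close>.\<close>
  have "(s powr p) powr (1 / p) * 1 powr (1 - 1 / p) \<le> 1 / p * s powr p + (1 - 1 / p) * 1"
    using assms(1) s by (intro Youngs_inequality_0) auto
  then have "s \<le> s powr p / p + (1 - 1 / p)" using assms(1) s by (simp add: powr_powr)
  then have "p * s \<le> p * (s powr p / p + (1 - 1 / p))" using assms(1) by (intro mult_left_mono) auto
  also have "\<dots> = s powr p + p - 1" using assms(1) by (simp add: field_simps)
  finally have "1 + p * (s - 1) \<le> s powr p" by (simp add: algebra_simps)
  then have "y powr p * (1 + p * (s - 1)) \<le> y powr p * s powr p" by (intro mult_left_mono) auto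
  also have "\<dots> = u powr p" using assms s by (simp add: s_def flip: powr_mult)
  finally show ?thesis
    using assms(3) by (simp add: s_def powr_diff field_simps)
qed

text \<open>The tangent of the p-th power at the weighted mean y = J / W is integrated; its linear
  part drops out because the mean is \<open>y\<close>.\<close>

lemma weighted_jensen_powr:
  fixes u w :: "'a \<Rightarrow> real"
  assumes p: "p \<ge> 1"
    and int: "integrable M w" "integrable M (\<lambda>x. u x * w x)" "integrable M (\<lambda>x. u x powr p * w x)"
    and nonneg: "\<And>x. x \<in> space M \<Longrightarrow> 0 \<le> u x" "\<And>x. x \<in> space M \<Longrightarrow> 0 \<le> w x"
  shows "(\<integral>x. u x * w x \<partial>M) powr p \<le> (\<integral>x. w x \<partial>M) powr (p - 1) * (\<integral>x. u x powr p * w x \<partial>M)"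
proof -
  define W J where "W = (\<integral>x. w x \<partial>M)" and "J = (\<integral>x. u x * w x \<partial>M)"
  have RHS: "0 \<le> (\<integral>x. u x powr p * w x \<partial>M)" using nonneg by (intro integral_nonneg_AE) auto
  have J0: "J = 0" if "W = 0"
  proof -
    have "AE x in M. w x = 0"
      using that int(1) nonneg(2) unfolding W_def by (subst (asm) integral_nonneg_eq_0_iff_AE) auto
    then show ?thesis unfolding J_def by (intro integral_eq_zero_AE) auto
  qed
  have W: "W \<ge> 0" unfolding W_def using nonneg by (intro integral_nonneg_AE) auto
  have J: "J \<ge> 0" unfolding J_def using nonneg by (intro integral_nonneg_AE) auto
  show ?thesis
  proof (cases "J = 0")
    case True
    then show ?thesis using RHS p by (simp flip: J_def)
  next
    case False
    then have W': "W > 0" using J0 W by fastforce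
    define y where "y = J / W"
    have y: "y > 0" using False J W' by (simp add: y_def)
    have "(\<integral>x. y powr p * w x + p * y powr (p - 1) * (u x * w x - y * w x) \<partial>M) \<le> (\<integral>x. u x powr p * w x \<partial>M)"
    proof (rule integral_mono)
      show "integrable M (\<lambda>x. y powr p * w x + p * y powr (p - 1) * (u x * w x - y * w x))"
        using int by simp
      fix x assume "x \<in> space M"
      then have "(y powr p + p * y powr (p - 1) * (u x - y)) * w x \<le> u x powr p * w x"
        using nonneg by (intro mult_right_mono powr_tangent_le p y) auto
      then show "y powr p * w x + p * y powr (p - 1) * (u x * w x - y * w x) \<le> u x powr p * w x"
        by (simp add: algebra_simps)
    qed (fact int)
    also have "(\<integral>x. y powr p * w x + p * y powr (p - 1) * (u x * w x - y * w x) \<partial>M)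
        = y powr p * W + p * y powr (p - 1) * (J - y * W)"
      using int by (simp add: W_def J_def)
    also have "\<dots> = y powr p * W" using W' by (simp add: y_def)
    finally have "W powr (p - 1) * (y powr p * W) \<le> W powr (p - 1) * (\<integral>x. u x powr p * w x \<partial>M)"
      by (intro mult_left_mono) auto
    moreover have "W powr (p - 1) * (y powr p * W) = J powr p"
      using W' J by (simp add: y_def powr_divide powr_diff field_simps)
    ultimately show ?thesis by (simp add: W_def J_def)
  qed
qed

section \<open>The integral representation of the operator\<close>

lemma taylor_coeff_bounds:
  assumes f: "f holomorphic_on ball 0 \<rho>" "\<rho> > 1"
  shows summable_norm_taylor_coeff: "summable (\<lambda>k. norm (taylor_coeff f k))"
    and sums_taylor_coeff: "norm z \<le> 1 \<Longrightarrow> (\<lambda>k. taylor_coeff f k * z ^ k) sums f z"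
proof -
  have s: "(\<lambda>k. taylor_coeff f k * z ^ k) sums f z" if "z \<in> ball 0 \<rho>" for z
    using holomorphic_power_series[OF f(1) that] by (simp add: taylor_coeff_def)
  define r where "r = (1 + \<rho>) / 2"
  have r: "1 < r" "r < \<rho>" using f(2) by (auto simp: r_def)
  have "summable (\<lambda>k. taylor_coeff f k * of_real r ^ k)"
    using s[of "of_real r"] r by (auto simp: sums_iff)
  then show "summable (\<lambda>k. norm (taylor_coeff f k))"
    using powser_insidea[of "taylor_coeff f" "of_real r" 1] r by simp
  show "(\<lambda>k. taylor_coeff f k * z ^ k) sums f z" if "norm z \<le> 1"
    using that f(2) by (intro s) auto
qed

context carleson_2 begin

lemma integrable_mu_bounded:
  fixes f :: "real \<Rightarrow> 'a::{banach, second_countable_topology}"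
  assumes "continuous_on {0..<1} f" "\<And>t. 0 \<le> t \<Longrightarrow> t < 1 \<Longrightarrow> norm (f t) \<le> B"
  shows "integrable \<mu> f"
  using assms by (intro finite_measure.integrable_const_bound[OF finite_mu, of _ B] AE_I2 borel_measurable_muI)
    (auto simp: space_mu)

text \<open>Holomorphy past the closed disc makes the Taylor coefficients absolutely summable, which
  justifies exchanging sum and integral on all of [0, 1).\<close>

lemma moment_coefficient_eq_integral:
  assumes f: "f holomorphic_on ball 0 \<rho>" "\<rho> > 1"
  shows "(\<Sum>k. of_real (moment \<mu> (n + k)) * taylor_coeff f k) = (\<integral>t. of_real t ^ n * f (of_real t) \<partial>\<mu>)"
proof -
  define a where "a = taylor_coeff f"
  define u where "u k t = of_real (t ^ (n + k)) * a k" for k t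
  have nu: "norm (u k t) \<le> norm (a k)" if "0 \<le> t" "t < 1" for k t
    using that by (auto simp: u_def norm_mult norm_power intro!: mult_left_le_one_le power_le_one)
  have iu: "integrable \<mu> (u k)" for k
    by (rule integrable_mu_bounded[OF _ nu]) (auto simp: u_def[abs_def] intro!: continuous_intros)
  have sa: "summable (\<lambda>k. norm (a k))" unfolding a_def by (rule summable_norm_taylor_coeff[OF f])
  have "(\<integral>t. (\<Sum>k. u k t) \<partial>\<mu>) = (\<Sum>k. \<integral>t. u k t \<partial>\<mu>)"
  proof (rule integral_suminf[OF iu])
    show "AE t in \<mu>. summable (\<lambda>k. norm (u k t))"
      by (intro AE_I2 summable_comparison_test'[OF sa, of 0]) (auto simp: space_mu nu)
    show "summable (\<lambda>k. \<integral>t. norm (u k t) \<partial>\<mu>)"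
    proof (rule summable_comparison_test'[OF summable_mult2[OF sa, of "measure \<mu> (space \<mu>)"], of 0])
      fix k
      have "(\<integral>t. norm (u k t) \<partial>\<mu>) \<le> (\<integral>t. norm (a k) \<partial>\<mu>)"
        using iu[of k] by (intro integral_mono) (auto simp: space_mu nu finite_measure.integrable_const[OF finite_mu])
      then show "norm (\<integral>t. norm (u k t) \<partial>\<mu>) \<le> norm (a k) * measure \<mu> (space \<mu>)"
        by (simp add: mult.commute)
    qed
  qed
  moreover have "(\<integral>t. u k t \<partial>\<mu>) = of_real (moment \<mu> (n + k)) * a k" for k
    by (simp add: u_def moment_def del: of_real_power)
  moreover have "(\<integral>t. (\<Sum>k. u k t) \<partial>\<mu>) = (\<integral>t. of_real t ^ n * f (of_real t) \<partial>\<mu>)"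
  proof (intro Bochner_Integration.integral_cong refl)
    fix t assume "t \<in> space \<mu>"
    then have "norm (of_real t :: complex) \<le> 1" by (auto simp: space_mu)
    from sums_mult[OF sums_taylor_coeff[OF f this], of "of_real t ^ n"]
    show "(\<Sum>k. u k t) = of_real t ^ n * f (of_real t)"
      by (simp add: u_def a_def sums_iff power_add mult_ac)
  qed
  ultimately show ?thesis by (simp add: a_def)
qed

lemma DH_eq_integral:
  assumes f: "f holomorphic_on ball 0 \<rho>" "\<rho> > 1" and z: "norm z < 1"
  shows "DH \<mu> f z = (\<integral>t. f (of_real t) / (1 - of_real t * z)\<^sup>2 \<partial>\<mu>)"
proof -
  define K where "K = (\<Sum>k. norm (taylor_coeff f k))"
  have contf: "continuous_on {0..<1} (\<lambda>t. f (of_real t))"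
    by (rule continuous_on_compose2[OF holomorphic_on_imp_continuous_on[OF f(1)]])
       (use f(2) in \<open>auto intro!: continuous_intros\<close>)
  have bf: "norm (f (of_real t)) \<le> K" if "0 \<le> t" "t < 1" for t
  proof -
    have nt: "norm (of_real t :: complex) \<le> 1" using that by simp
    have le: "norm (taylor_coeff f k * of_real t ^ k) \<le> norm (taylor_coeff f k)" for k
      using that by (simp add: norm_mult norm_power mult_left_le power_le_one)
    have sm: "summable (\<lambda>k. norm (taylor_coeff f k * of_real t ^ k))"
      by (rule summable_comparison_test'[OF summable_norm_taylor_coeff[OF f], of 0]) (use le in auto)
    have "norm (\<Sum>k. taylor_coeff f k * of_real t ^ k) \<le> K"
      unfolding K_def by (rule order_trans[OF summable_norm[OF sm] suminf_le[OF le sm summable_norm_taylor_coeff[OF f]]])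
    then show ?thesis using sums_taylor_coeff[OF f nt] by (simp add: sums_iff)
  qed
  have K: "K \<ge> 0" using order_trans[OF norm_ge_zero bf[of 0]] by simp
  define u where "u n t = of_nat (n + 1) * (of_real t ^ n * f (of_real t)) * z ^ n" for n t
  have nu: "norm (u n t) \<le> K * (real (Suc n) * norm z ^ n)" if "0 \<le> t" "t < 1" for n t
  proof -
    have "norm (u n t) = real (Suc n) * (t ^ n * norm (f (of_real t))) * norm z ^ n"
      using that by (simp add: u_def norm_mult norm_power del: of_nat_Suc of_nat_add)
    also have "\<dots> \<le> real (Suc n) * (1 * K) * norm z ^ n"
      using that bf[OF that] K by (intro mult_right_mono mult_left_mono mult_mono power_le_one) auto
    finally show ?thesis by (simp add: mult_ac)
  qed
  have iu: "integrable \<mu> (u n)" for n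
  proof (rule integrable_mu_bounded[OF _ nu])
    show "continuous_on {0..<1} (u n)" unfolding u_def by (intro continuous_intros contf)
  qed
  have sz: "summable (\<lambda>n. K * (real (Suc n) * norm z ^ n))"
    using geometric_deriv_sums[of "norm z"] z by (intro summable_mult) (auto simp: sums_iff)
  have "(\<integral>t. (\<Sum>n. u n t) \<partial>\<mu>) = (\<Sum>n. \<integral>t. u n t \<partial>\<mu>)"
  proof (rule integral_suminf[OF iu])
    show "AE t in \<mu>. summable (\<lambda>n. norm (u n t))"
      by (intro AE_I2 summable_comparison_test'[OF sz, of 0]) (auto simp: space_mu simp del: of_nat_Suc intro: nu)
    show "summable (\<lambda>n. \<integral>t. norm (u n t) \<partial>\<mu>)"
    proof (rule summable_comparison_test'[OF summable_mult2[OF sz, of "measure \<mu> (space \<mu>)"], of 0])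
      fix n
      have "(\<integral>t. norm (u n t) \<partial>\<mu>) \<le> (\<integral>t. K * (real (Suc n) * norm z ^ n) \<partial>\<mu>)"
        using iu[of n] by (intro integral_mono nu integrable_norm finite_measure.integrable_const[OF finite_mu]) (auto simp: space_mu)
      then show "norm (\<integral>t. norm (u n t) \<partial>\<mu>) \<le> K * (real (Suc n) * norm z ^ n) * measure \<mu> (space \<mu>)"
        by (simp add: mult_ac)
    qed
  qed
  moreover have "(\<integral>t. u n t \<partial>\<mu>) = of_nat (n + 1) * (\<Sum>k. of_real (moment \<mu> (n + k)) * taylor_coeff f k) * z ^ n" for n
    unfolding moment_coefficient_eq_integral[OF f] u_def by simp
  moreover have "(\<integral>t. (\<Sum>n. u n t) \<partial>\<mu>) = (\<integral>t. f (of_real t) / (1 - of_real t * z)\<^sup>2 \<partial>\<mu>)"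
  proof (intro Bochner_Integration.integral_cong refl)
    fix t assume "t \<in> space \<mu>"
    then have t: "0 \<le> t" "t < 1" by (auto simp: space_mu)
    have "t * norm z \<le> 1 * norm z" using t by (intro mult_right_mono) auto
    then have "norm (of_real t * z) < 1" using t z by (simp add: norm_mult)
    from sums_mult[OF geometric_deriv_sums[OF this], of "f (of_real t)"]
    show "(\<Sum>n. u n t) = f (of_real t) / (1 - of_real t * z)\<^sup>2"
      by (simp add: u_def sums_iff power_mult_distrib mult_ac)
  qed
  ultimately show ?thesis by (simp add: DH_def)
qed

text \<open>With k = |1 - t z|, the integrand |f| / k^2 is split as (|f| sqrt k) times the weight
  k^(-5/2). Jensen leaves |f|^p k^((p - 5) / 2) |1 - z|^(-(p - 1) / 2), whose kernel has total
  degree -2 whatever \<open>p\<close> is, so it can be compared with the kernel of the case p =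
  2.\<close>

lemma norm_DH_powr_le:
  assumes f: "f holomorphic_on ball 0 \<rho>" "\<rho> > 1" and z: "norm z < 1" and p: "1 \<le> p" "p \<le> 2"
  shows "ennreal (norm (DH \<mu> f z) powr p) \<le>
    (\<integral>\<^sup>+ t. ennreal (2 * (64 * moment_const) powr (p - 1) * norm (f (of_real t)) powr p *
       (1 / (sqrt (norm (1 - z)) * sqrt (norm (1 - of_real t * z)) ^ 3))) \<partial>\<mu>)"
proof -
  define k where "k t = norm (1 - of_real t * z)" for t
  define E where "E = norm (1 - z)"
  define L where "L = 64 * moment_const"
  have L: "L \<ge> 0" using moment_const_nonneg by (simp add: L_def)
  have E: "E > 0" "E \<le> 2"
    using z norm_triangle_ineq4[of 1 z] by (auto simp: E_def)
  have k: "k t \<ge> 1 - norm z" "k t > 0" "E / 2 \<le> k t" if "0 \<le> t" "t < 1" for t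
  proof -
    have "t * norm z \<le> 1 * norm z" using that by (intro mult_right_mono) auto
    then show "k t \<ge> 1 - norm z"
      using norm_triangle_ineq2[of 1 "of_real t * z"] that by (simp add: norm_mult k_def)
    then show "k t > 0" using z by simp
    show "E / 2 \<le> k t"
      using norm_one_minus_le_norm_one_minus_mult(2)[of z t] that z by (simp add: k_def E_def)
  qed
  have contf: "continuous_on {0..1} (\<lambda>t. f (of_real t))"
    by (rule continuous_on_compose2[OF holomorphic_on_imp_continuous_on[OF f(1)]])
       (use f(2) in \<open>auto intro!: continuous_intros\<close>)
  have contk: "continuous_on {0..1} k" unfolding k_def by (intro continuous_intros)
  have knz: "k t > 0" if "0 \<le> t" "t \<le> 1" for t
  proof (cases "t = 1")
    case True
    then show ?thesis using E by (simp add: k_def E_def)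
  qed (use k that in auto)
  \<comment> \<open>The functions extend continuously to t = 1, since k 1 = |1 - z| is positive;
    compactness then bounds them.\<close>
  have int: "integrable \<mu> g" if "continuous_on {0..1} g" for g :: "real \<Rightarrow> real"
  proof -
    have "compact (g ` {0..1})" by (intro compact_continuous_image that) auto
    then obtain B where B: "\<And>x. x \<in> g ` {0..1} \<Longrightarrow> norm x \<le> B"
      using compact_imp_bounded bounded_iff by metis
    show ?thesis
    proof (rule integrable_mu_bounded[where B = B])
      show "continuous_on {0..<1} g" by (rule continuous_on_subset[OF that]) auto
    qed (use B in auto)
  qed
  define u where "u t = norm (f (of_real t)) * sqrt (k t)" for t
  define w where "w t = 1 / sqrt (k t) ^ 5" for t
  have cu: "continuous_on {0..1} u" unfolding u_def by (intro continuous_intros contf contk)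
  have cw: "continuous_on {0..1} w" unfolding w_def
    using knz by (intro continuous_intros contk) force
  have cup: "continuous_on {0..1} (\<lambda>t. u t powr p)"
    using p by (intro continuous_on_powr' cu continuous_intros) (auto simp: u_def k_def)
  have u0: "0 \<le> u t" and w0: "0 \<le> w t" for t by (auto simp: u_def w_def k_def)
  have uw: "u t * w t = norm (f (of_real t) / (1 - of_real t * z)\<^sup>2)" if "0 \<le> t" "t < 1" for t
  proof -
    have "sqrt (k t) / sqrt (k t) ^ 5 = 1 / (k t)\<^sup>2"
    proof -
      define s where "s = sqrt (k t)"
      have "s > 0" "k t = s\<^sup>2" using k(2)[OF that] by (auto simp: s_def)
      then show ?thesis by (simp flip: s_def add: field_simps power_numeral_reduce)
    qed
    moreover have "u t * w t = norm (f (of_real t)) * (sqrt (k t) / sqrt (k t) ^ 5)"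
      by (simp add: u_def w_def)
    ultimately show ?thesis by (simp add: norm_divide norm_power k_def)
  qed
  have W: "(\<integral>t. w t \<partial>\<mu>) \<le> L / sqrt E"
  proof -
    have "ennreal (\<integral>t. w t \<partial>\<mu>) = (\<integral>\<^sup>+ t. ennreal (w t) \<partial>\<mu>)"
      using int[OF cw] w0 by (intro nn_integral_eq_integral[symmetric]) auto
    also have "\<dots> \<le> ennreal (L / sqrt E)"
      using nn_integral_kernel_le[OF z] by (simp add: w_def k_def L_def E_def)
    finally show ?thesis using L E by (subst (asm) ennreal_le_iff) auto
  qed
  have W0: "0 \<le> (\<integral>t. w t \<partial>\<mu>)" using w0 by (intro integral_nonneg_AE) auto
  have "norm (DH \<mu> f z) \<le> (\<integral>t. norm (f (of_real t) / (1 - of_real t * z)\<^sup>2) \<partial>\<mu>)"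
    unfolding DH_eq_integral[OF f z] by (rule integral_norm_bound)
  also have "\<dots> = (\<integral>t. u t * w t \<partial>\<mu>)"
    by (intro Bochner_Integration.integral_cong refl) (auto simp: space_mu uw)
  finally have "norm (DH \<mu> f z) powr p \<le> (\<integral>t. u t * w t \<partial>\<mu>) powr p"
    using p by (intro powr_mono2) auto
  also have "\<dots> \<le> (\<integral>t. w t \<partial>\<mu>) powr (p - 1) * (\<integral>t. u t powr p * w t \<partial>\<mu>)"
    using p cu cw cup u0 w0
    by (intro weighted_jensen_powr int continuous_on_mult) auto
  also have "\<dots> \<le> (L / sqrt E) powr (p - 1) * (\<integral>t. u t powr p * w t \<partial>\<mu>)"
    using W W0 p u0 w0 by (intro mult_right_mono powr_mono2 integral_nonneg_AE) auto
  also have "\<dots> = (\<integral>t. (L / sqrt E) powr (p - 1) * (u t powr p * w t) \<partial>\<mu>)" by simp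
  finally have "ennreal (norm (DH \<mu> f z) powr p) \<le> ennreal (\<integral>t. (L / sqrt E) powr (p - 1) * (u t powr p * w t) \<partial>\<mu>)"
    by (rule ennreal_leI)
  also have "\<dots> = (\<integral>\<^sup>+ t. ennreal ((L / sqrt E) powr (p - 1) * (u t powr p * w t)) \<partial>\<mu>)"
    using cw cup w0
    by (intro nn_integral_eq_integral[symmetric] int continuous_on_mult continuous_on_const) auto
  also have "\<dots> \<le> (\<integral>\<^sup>+ t. ennreal (2 * L powr (p - 1) * norm (f (of_real t)) powr p * (1 / (sqrt E * sqrt (k t) ^ 3))) \<partial>\<mu>)"
  proof (intro nn_integral_mono ennreal_leI)
    fix t assume "t \<in> space \<mu>"
    then have t: "0 \<le> t" "t < 1" by (auto simp: space_mu)
    define s e where "s = sqrt (k t)" and "e = sqrt E"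
    have s: "s > 0" "e > 0" "e \<le> 2 * s"
    proof -
      show "s > 0" "e > 0" using k(2)[OF t] E by (auto simp: s_def e_def)
      have "e \<le> sqrt (4 * k t)" unfolding e_def using k[OF t] by (intro real_sqrt_le_mono) simp
      then show "e \<le> 2 * s" by (simp add: real_sqrt_mult s_def)
    qed
    \<comment> \<open>As \<open>p \<le> 2\<close>, the spare factor \<open>(e / s) powr (2 - p)\<close> is bounded, so the kernel no longer depends on \<open>p\<close>.\<close>
    have "(s powr p * w t) * (1 / e powr (p - 1)) = (e / s) powr (2 - p) * (1 / (e * s ^ 3))"
    proof -
      have w: "w t = s powr (-5)" using s by (simp add: w_def s_def powr_minus divide_inverse powr_numeral)
      have es: "1 / (e * s ^ 3) = e powr (-1) * s powr (-3)"
        using s by (simp add: powr_minus divide_inverse powr_numeral)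
      have e1: "1 / e powr (p - 1) = e powr (1 - p)" using s by (simp add: powr_diff)
      have e2: "e powr (1 - p) = e powr (2 - p) * e powr (-1)"
        by (subst powr_add[symmetric]) simp
      have s1: "s powr p * s powr (-5) = s powr (p - 2) * s powr (-3)"
        by (subst (1 2) powr_add[symmetric]) simp
      have q: "(e / s) powr (2 - p) = e powr (2 - p) * s powr (p - 2)"
        using s by (simp add: powr_divide powr_diff)
      show ?thesis unfolding w es e1 q s1 e2 by (simp only: mult_ac)
    qed
    also have "\<dots> \<le> 2 * (1 / (e * s ^ 3))"
    proof (intro mult_right_mono)
      have "(e / s) powr (2 - p) \<le> 2 powr (2 - p)"
        using s p by (intro powr_mono2) (auto simp: field_simps)
      also have "\<dots> \<le> 2 powr 1" using p by (intro powr_mono) auto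
      finally show "(e / s) powr (2 - p) \<le> 2" by simp
    qed (use s in auto)
    finally have "L powr (p - 1) * norm (f (of_real t)) powr p * ((s powr p * w t) * (1 / e powr (p - 1)))
        \<le> L powr (p - 1) * norm (f (of_real t)) powr p * (2 * (1 / (e * s ^ 3)))"
      by (intro mult_left_mono) auto
    moreover have "(L / sqrt E) powr (p - 1) = L powr (p - 1) / e powr (p - 1)"
      using L s by (simp add: powr_divide e_def)
    moreover have "u t powr p = norm (f (of_real t)) powr p * s powr p"
      using s by (simp add: u_def powr_mult s_def)
    ultimately show "(L / sqrt E) powr (p - 1) * (u t powr p * w t)
        \<le> 2 * L powr (p - 1) * norm (f (of_real t)) powr p * (1 / (sqrt E * sqrt (k t) ^ 3))"
      by (simp add: mult_ac s_def e_def)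
  qed
  finally show ?thesis by (simp add: L_def E_def k_def)
qed

text \<open>In order: the constant of \<open>norm_DH_powr_le\<close>, the angular integral 120, and
  16 \<open>moment_const\<close> from the H^2 embedding; the divisor 2 pi comes from Parseval's
  identity.\<close>

definition bound_const :: "real \<Rightarrow> real" where
  "bound_const p = 2 * (64 * moment_const) powr (p - 1) * 120 * 16 * moment_const / (2 * pi)"

lemma bound_const_nonneg: "bound_const p \<ge> 0"
  using moment_const_nonneg by (simp add: bound_const_def)

lemma nn_integral_DH_le:
  assumes f: "f holomorphic_on ball 0 \<rho>" "\<rho> > 1" and nz: "\<And>z. norm z = 1 \<Longrightarrow> f z \<noteq> 0"
    and r: "0 \<le> r" "r < 1" and p: "1 \<le> p" "p \<le> 2"
  shows "(\<integral>\<^sup>+ \<theta>. ennreal (norm (DH \<mu> f (of_real r * cis \<theta>)) powr p) * indicator {0..2 * pi} \<theta> \<partial>lborel)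
    \<le> ennreal (bound_const p * integral {0..2 * pi} (\<lambda>\<theta>. norm (f (cis \<theta>)) powr p))"
proof -
  obtain A :: "nat \<Rightarrow> complex" where A: "summable (\<lambda>k. norm (A k))"
    "\<And>z. norm z = 1 \<Longrightarrow> (norm (\<Sum>k. A k * z ^ k))\<^sup>2 = norm (f z) powr p"
    "\<And>z. norm z < 1 \<Longrightarrow> p > 0 \<Longrightarrow> norm (f z) powr p \<le> (norm (\<Sum>k. A k * z ^ k))\<^sup>2"
    by (rule powr_majorant_power_series[where p = p, OF f]) (erule nz, rule that)
  define D where "D = 2 * (64 * moment_const) powr (p - 1)"
  have D: "D \<ge> 0" by (simp add: D_def)
  define G where "G \<theta> t = 1 / (sqrt (norm (1 - of_real r * cis \<theta>))
      * sqrt (norm (1 - of_real t * (of_real r * cis \<theta>))) ^ 3)" for \<theta> t :: real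
  define H where "H t = ennreal (D * norm (f (of_real t)) powr p)" for t :: real
  have contf: "continuous_on {0..<1} (\<lambda>t. f (of_real t))"
    by (rule continuous_on_compose2[OF holomorphic_on_imp_continuous_on[OF f(1)]])
       (use f(2) in \<open>auto intro!: continuous_intros\<close>)
  have mH [measurable]: "H \<in> borel_measurable \<mu>" unfolding H_def
  proof (intro measurable_compose[OF _ measurable_ennreal] borel_measurable_muI)
    show "continuous_on {0..<1} (\<lambda>t. D * norm (f (of_real t)) powr p)"
      using p by (intro continuous_intros continuous_on_powr' contf) auto
  qed
  have [measurable]: "cis \<in> borel_measurable borel"
    by (intro borel_measurable_continuous_onI continuous_intros)
  have mG [measurable]: "(\<lambda>(\<theta>, t). G \<theta> t) \<in> borel_measurable (lborel \<Otimes>\<^sub>M \<mu>)"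
    unfolding G_def by measurable
  interpret mu: finite_measure \<mu> by (rule finite_mu)
  interpret pair_sigma_finite lborel \<mu> ..
  have "(\<integral>\<^sup>+ \<theta>. ennreal (norm (DH \<mu> f (of_real r * cis \<theta>)) powr p) * indicator {0..2 * pi} \<theta> \<partial>lborel)
      \<le> (\<integral>\<^sup>+ \<theta>. (\<integral>\<^sup>+ t. H t * (ennreal (G \<theta> t) * indicator {0..2 * pi} \<theta>) \<partial>\<mu>) \<partial>lborel)"
  proof (rule nn_integral_mono)
    fix \<theta> :: real
    have "norm (of_real r * cis \<theta>) < 1" using r by (simp add: norm_mult)
    note * = norm_DH_powr_le[OF f this p]
    have "ennreal (D * norm (f (of_real t)) powr p * (1 / (sqrt (norm (1 - of_real r * cis \<theta>))
      * sqrt (norm (1 - of_real t * (of_real r * cis \<theta>))) ^ 3))) = H t * ennreal (G \<theta> t)" for t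
      unfolding H_def G_def using D by (intro ennreal_mult) auto
    then have **: "ennreal (norm (DH \<mu> f (of_real r * cis \<theta>)) powr p) \<le> (\<integral>\<^sup>+ t. H t * ennreal (G \<theta> t) \<partial>\<mu>)"
      using * by (simp add: D_def)
    then show "ennreal (norm (DH \<mu> f (of_real r * cis \<theta>)) powr p) * indicator {0..2 * pi} \<theta>
        \<le> (\<integral>\<^sup>+ t. H t * (ennreal (G \<theta> t) * indicator {0..2 * pi} \<theta>) \<partial>\<mu>)"
      by (auto simp: indicator_def)
  qed
  also have "\<dots> = (\<integral>\<^sup>+ t. (\<integral>\<^sup>+ \<theta>. H t * (ennreal (G \<theta> t) * indicator {0..2 * pi} \<theta>) \<partial>lborel) \<partial>\<mu>)"
    by (rule Fubini'[symmetric]) measurable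
  \<comment> \<open>On the radius \<open>f\<close> is replaced by its majorant, to whose square the
    H^2 embedding applies.\<close>
  also have "\<dots> \<le> (\<integral>\<^sup>+ t. ennreal (D * 120) * ennreal ((norm (\<Sum>k. A k * of_real t ^ k))\<^sup>2 / (1 - t)) \<partial>\<mu>)"
  proof (rule nn_integral_mono)
    fix t assume "t \<in> space \<mu>"
    then have t: "0 \<le> t" "t < 1" by (auto simp: space_mu)
    have [measurable]: "(\<lambda>\<theta>. G \<theta> t) \<in> borel_measurable lborel"
      using measurable_compose[OF measurable_Pair2'[OF \<open>t \<in> space \<mu>\<close>] mG] by simp
    have "(\<integral>\<^sup>+ \<theta>. H t * (ennreal (G \<theta> t) * indicator {0..2 * pi} \<theta>) \<partial>lborel)
        = H t * (\<integral>\<^sup>+ \<theta>. ennreal (G \<theta> t) * indicator {0..2 * pi} \<theta> \<partial>lborel)"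
      by (rule nn_integral_cmult) measurable
    also have "\<dots> \<le> ennreal (D * (norm (\<Sum>k. A k * of_real t ^ k))\<^sup>2) * ennreal (120 / (1 - t))"
      unfolding H_def G_def using t r p D
      by (intro mult_mono nn_integral_angular_kernel_le ennreal_leI mult_left_mono A(3)) auto
    also have "\<dots> = ennreal (D * 120) * ennreal ((norm (\<Sum>k. A k * of_real t ^ k))\<^sup>2 / (1 - t))"
      using t D by (subst (1 2) ennreal_mult[symmetric]) auto
    finally show "(\<integral>\<^sup>+ \<theta>. H t * (ennreal (G \<theta> t) * indicator {0..2 * pi} \<theta>) \<partial>lborel)
        \<le> ennreal (D * 120) * ennreal ((norm (\<Sum>k. A k * of_real t ^ k))\<^sup>2 / (1 - t))" .
  qed
  also have "\<dots> = ennreal (D * 120) * (\<integral>\<^sup>+ t. ennreal ((norm (\<Sum>k. A k * of_real t ^ k))\<^sup>2 / (1 - t)) \<partial>\<mu>)"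
    by (rule nn_integral_cmult) measurable
  also have "\<dots> \<le> ennreal (D * 120) * ennreal (16 * moment_const * (\<Sum>k. (norm (A k))\<^sup>2))"
    by (intro mult_left_mono nn_integral_power_series_le A) auto
  also have "\<dots> = ennreal (D * 120 * (16 * moment_const * (\<Sum>k. (norm (A k))\<^sup>2)))"
    using D by (subst ennreal_mult') auto
  also have "D * 120 * (16 * moment_const * (\<Sum>k. (norm (A k))\<^sup>2))
      = bound_const p * (2 * pi * (\<Sum>k. (norm (A k))\<^sup>2))"
    by (simp add: bound_const_def D_def)
  \<comment> \<open>On the circle the majorant has the modulus of \<open>f\<close> to the power p /
    2, so Parseval's identity leads back to \<open>f\<close> without loss.\<close>
  also have "2 * pi * (\<Sum>k. (norm (A k))\<^sup>2) = integral {0..2 * pi} (\<lambda>\<theta>. norm (f (cis \<theta>)) powr p)"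
    using integral_unique[OF parseval_circle[OF A(1)]] A(2) by simp
  finally show ?thesis .
qed

end

section \<open>Passage to Hardy spaces\<close>

text \<open>For p > 0 this is 2 pi times the p-th power of \<open>integral_mean\<close>; without the
  root, norm bounds become linear inequalities between integrals.\<close>

definition circle_integral :: "real \<Rightarrow> (complex \<Rightarrow> complex) \<Rightarrow> real \<Rightarrow> real" where
  "circle_integral p f r = integral {0..2 * pi} (\<lambda>\<theta>. norm (f (of_real r * cis \<theta>)) powr p)"

lemma continuous_on_circle:
  assumes "f holomorphic_on ball 0 1" "0 \<le> r" "r < 1"
  shows "continuous_on S (\<lambda>\<theta>. f (of_real r * cis \<theta>))"
  by (rule continuous_on_compose2[OF holomorphic_on_imp_continuous_on[OF assms(1)]])
     (use assms in \<open>auto intro!: continuous_intros simp: norm_mult\<close>)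

lemma continuous_on_circle_powr:
  assumes "f holomorphic_on ball 0 1" "0 \<le> r" "r < 1" "p > 0"
  shows "continuous_on S (\<lambda>\<theta>. norm (f (of_real r * cis \<theta>)) powr p)"
  using assms(4) by (intro continuous_on_powr' continuous_on_norm continuous_on_circle assms continuous_on_const) auto

lemma circle_integral_nonneg: "0 \<le> circle_integral p f r"
  unfolding circle_integral_def by (cases "(\<lambda>\<theta>. norm (f (of_real r * cis \<theta>)) powr p) integrable_on {0..2 * pi}")
    (auto intro!: integral_nonneg simp: not_integrable_integral)

lemma integral_mean_le_iff:
  assumes "p > 0" "N \<ge> 0"
  shows "integral_mean p f r \<le> N \<longleftrightarrow> circle_integral p f r \<le> 2 * pi * N powr p"
proof -
  define x where "x = 1 / (2 * pi) * circle_integral p f r"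
  have x: "x \<ge> 0" using circle_integral_nonneg by (simp add: x_def)
  have "integral_mean p f r = x powr (1 / p)"
    by (simp add: integral_mean_def x_def circle_integral_def)
  moreover have "x powr (1 / p) \<le> N \<longleftrightarrow> x \<le> N powr p"
  proof
    assume "x powr (1 / p) \<le> N"
    then have "(x powr (1 / p)) powr p \<le> N powr p" using assms by (intro powr_mono2) auto
    then show "x \<le> N powr p" using assms x by (simp add: powr_powr)
  next
    assume "x \<le> N powr p"
    then have "x powr (1 / p) \<le> (N powr p) powr (1 / p)" using assms x by (intro powr_mono2) auto
    then show "x powr (1 / p) \<le> N" using assms by (simp add: powr_powr)
  qed
  moreover have "x \<le> N powr p \<longleftrightarrow> circle_integral p f r \<le> 2 * pi * N powr p"
    by (simp add: x_def field_simps)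
  ultimately show ?thesis by simp
qed

lemma hardy_norm_le_iff:
  assumes "p > 0" "N \<ge> 0"
  shows "hardy_norm p f \<le> ennreal N \<longleftrightarrow> (\<forall>r\<in>{0<..<1}. circle_integral p f r \<le> 2 * pi * N powr p)"
  unfolding hardy_norm_def
  by (auto simp: SUP_le_iff ennreal_le_iff[OF assms(2)] integral_mean_le_iff[OF assms])

lemma coefficient_disc:
  assumes f: "f holomorphic_on ball 0 1" and R: "0 < R" "R < 1"
  shows "((\<lambda>\<theta>. cis (- real k * \<theta>) * f (of_real R * cis \<theta>)) has_integral
    2 * pi * (taylor_coeff f k * of_real R ^ k)) {0..2 * pi}"
proof -
  have s: "(\<lambda>k. taylor_coeff f k * z ^ k) sums f z" if "z \<in> ball 0 1" for z
    using holomorphic_power_series[OF f that] by (simp add: taylor_coeff_def)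
  define r where "r = (1 + R) / 2"
  have r: "R < r" "r < 1" using R by (auto simp: r_def)
  have "summable (\<lambda>k. taylor_coeff f k * of_real r ^ k)"
    using s[of "of_real r"] r R by (auto simp: sums_iff)
  then have sm: "summable (\<lambda>k. norm (taylor_coeff f k * of_real R ^ k))"
    using powser_insidea[of "taylor_coeff f" "of_real r" "of_real R"] r R by simp
  have "(\<Sum>j. taylor_coeff f j * of_real R ^ j * cis \<theta> ^ j) = f (of_real R * cis \<theta>)" for \<theta>
    using s[of "of_real R * cis \<theta>"] R by (simp add: sums_iff norm_mult power_mult_distrib mult_ac)
  with coefficient_circle[OF sm, of k] show ?thesis by simp
qed

text \<open>The crude x \<le> 1 + x^p replaces Hoelder's inequality: boundedness of the coefficients
  is all that is needed against the summable moments. Here \<open>N\<close> bounds the mean of the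
  p-th power.\<close>

lemma norm_taylor_coeff_le:
  assumes f: "f holomorphic_on ball 0 1" and p: "p \<ge> 1"
    and N: "\<And>r. 0 < r \<Longrightarrow> r < 1 \<Longrightarrow> circle_integral p f r \<le> 2 * pi * N"
  shows "norm (taylor_coeff f k) \<le> 1 + N"
proof -
  have le: "norm (taylor_coeff f k) * R ^ k \<le> 1 + N" if R: "0 < R" "R < 1" for R
  proof -
    note h = coefficient_disc[OF f R, of k]
    have i1: "(\<lambda>\<theta>. norm (f (of_real R * cis \<theta>)) powr p) integrable_on {0..2 * pi}"
      using p R by (intro integrable_continuous_interval continuous_on_circle_powr f) auto
    have "norm (integral {0..2 * pi} (\<lambda>\<theta>. cis (- real k * \<theta>) * f (of_real R * cis \<theta>)))
        \<le> integral {0..2 * pi} (\<lambda>\<theta>. 1 + norm (f (of_real R * cis \<theta>)) powr p)"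
    proof (rule integral_norm_bound_integral)
      show "(\<lambda>\<theta>. cis (- real k * \<theta>) * f (of_real R * cis \<theta>)) integrable_on {0..2 * pi}"
        using h by blast
      show "(\<lambda>\<theta>. 1 + norm (f (of_real R * cis \<theta>)) powr p) integrable_on {0..2 * pi}"
        by (intro integrable_add i1) auto
      fix \<theta>
      define x where "x = norm (f (of_real R * cis \<theta>))"
      have "x \<le> 1 + x powr p"
      proof (cases "x \<le> 1")
        case True
        then show ?thesis by (simp add: add_increasing2)
      next
        case False
        then have "x powr 1 \<le> x powr p" using p by (intro powr_mono) auto
        then show ?thesis using False by simp
      qed
      then show "norm (cis (- real k * \<theta>) * f (of_real R * cis \<theta>)) \<le> 1 + norm (f (of_real R * cis \<theta>)) powr p"
        by (simp add: norm_mult x_def)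
    qed
    also have "\<dots> = 2 * pi + circle_integral p f R"
      unfolding circle_integral_def by (subst integral_add) (use i1 in auto)
    also have "\<dots> \<le> 2 * pi * (1 + N)" using N[OF R] by (simp add: algebra_simps)
    finally have "2 * pi * (norm (taylor_coeff f k) * R ^ k) \<le> 2 * pi * (1 + N)"
      using integral_unique[OF h] R by (simp add: norm_mult norm_power)
    then show ?thesis by simp
  qed
  have "((\<lambda>R. norm (taylor_coeff f k) * R ^ k) \<longlongrightarrow> norm (taylor_coeff f k) * 1 ^ k) (at_left 1)"
    by (intro tendsto_intros)
  then have "norm (taylor_coeff f k) * 1 ^ k \<le> 1 + N"
    by (rule tendsto_upperbound)
       (use le eventually_at_left_real[of 0 "1::real"] in \<open>auto elim!: eventually_mono\<close>)
  then show ?thesis by simp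
qed

section \<open>Dilations by radii that avoid the zeros, and the growth estimate\<close>

lemma good_radius:
  assumes f: "f holomorphic_on ball 0 1" and nz: "\<exists>z\<in>ball 0 1. f z \<noteq> 0" and a: "0 \<le> a" "a < 1"
  obtains R where "a < R" "R < 1" "\<And>z. norm z = R \<Longrightarrow> f z \<noteq> 0"
proof -
  define c where "c = (1 + a) / 2"
  have c: "a < c" "c < 1" using a by (auto simp: c_def)
  have "finite {z \<in> cball 0 c. f z = 0}"
  proof (cases "f constant_on ball 0 1")
    case True
    then have "{z \<in> cball 0 c. f z = 0} = {}" using nz c unfolding constant_on_def by force
    then show ?thesis by (simp only: finite.emptyI)
  next
    case False
    then show ?thesis
      by (intro holomorphic_compact_finite_zeros[OF f]) (use c in auto)
  qed
  \<comment> \<open>Finitely many zeros occupy finitely many radii, while the interval from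
    \<open>a\<close> to \<open>c\<close> is infinite.\<close>
  then have "finite (norm ` {z \<in> cball 0 c. f z = 0})" by (rule finite_imageI)
  moreover have "infinite {a<..<c}" using c by simp
  ultimately have "\<not> {a<..<c} \<subseteq> norm ` {z \<in> cball 0 c. f z = 0}" using finite_subset by blast
  then obtain R where R: "a < R" "R < c" "R \<notin> norm ` {z \<in> cball 0 c. f z = 0}"
    by (meson greaterThanLessThan_iff subsetI)
  show ?thesis by (rule that[of R]) (use R c in auto)
qed

lemma good_radii:
  assumes f: "f holomorphic_on ball 0 1" and nz: "\<exists>z\<in>ball 0 1. f z \<noteq> 0"
  obtains R :: "nat \<Rightarrow> real" where "\<And>j. 0 < R j" "\<And>j. R j < 1" "R \<longlonglongrightarrow> 1"
    "\<And>j z. norm z = R j \<Longrightarrow> f z \<noteq> 0"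
proof -
  have "\<exists>R. 1 - 1 / real (Suc j) < R \<and> R < 1 \<and> (\<forall>z. norm z = R \<longrightarrow> f z \<noteq> 0)" for j
    by (rule good_radius[OF f nz, of "1 - 1 / real (Suc j)"]) (auto simp: field_simps)
  then obtain R where R: "\<And>j. 1 - 1 / real (Suc j) < R j" "\<And>j. R j < 1"
    "\<And>j z. norm z = R j \<Longrightarrow> f z \<noteq> 0"
    by metis
  have "R j > 0" for j using R(1)[of j] by (rule le_less_trans[rotated]) (simp add: field_simps)
  moreover have "R \<longlonglongrightarrow> 1"
  proof (rule tendsto_sandwich)
    show "(\<lambda>j. 1 - 1 / real (Suc j)) \<longlonglongrightarrow> 1" by real_asymp
  qed (use R in \<open>auto simp: less_imp_le\<close>)
  ultimately show ?thesis using that R by blast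
qed

lemma dilation:
  assumes f: "f holomorphic_on ball 0 1" and R: "0 < R" "R < 1"
  shows holomorphic_dilation: "(\<lambda>z. f (of_real R * z)) holomorphic_on ball 0 (1 / R)"
    and taylor_coeff_dilation: "taylor_coeff (\<lambda>z. f (of_real R * z)) k = of_real R ^ k * taylor_coeff f k"
proof -
  have sub: "of_real R * z \<in> ball 0 1" if "z \<in> ball 0 (1 / R)" for z :: complex
    using that R by (simp add: norm_mult field_simps)
  have "(\<lambda>z::complex. of_real R * z) ` ball 0 (1 / R) \<subseteq> ball 0 1" using sub by blast
  moreover have "(\<lambda>z::complex. of_real R * z) holomorphic_on ball 0 (1 / R)" by (intro holomorphic_intros)
  ultimately show "(\<lambda>z. f (of_real R * z)) holomorphic_on ball 0 (1 / R)"
    using holomorphic_on_compose_gen[OF _ f] by (simp add: o_def)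
  have "(deriv ^^ k) (\<lambda>z. f (of_real R * z)) 0 = of_real R ^ k * (deriv ^^ k) f (of_real R * 0)"
    by (rule higher_deriv_compose_linear[OF f, of "ball 0 (1 / R)"]) (use R sub in auto)
  then show "taylor_coeff (\<lambda>z. f (of_real R * z)) k = of_real R ^ k * taylor_coeff f k"
    by (simp add: taylor_coeff_def)
qed

text \<open>At a good radius this is the reproducing-kernel bound of H^2 for the majorant:
  Cauchy-Schwarz gives the square sum of its coefficients times the sum of b^(2 k), and by
  Parseval's identity the former is the mean of |f|^p on that circle. The radii then tend to
  1.\<close>

lemma pointwise_bound:
  assumes f: "f holomorphic_on ball 0 1" and p: "p > 0" and b: "0 \<le> b" "b < 1"
    and J: "\<And>r. 0 < r \<Longrightarrow> r < 1 \<Longrightarrow> circle_integral p f r \<le> 2 * pi * J"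
  shows "norm (f (of_real b)) powr p \<le> J / (1 - b\<^sup>2)"
proof (cases "\<exists>z\<in>ball 0 1. f z \<noteq> 0")
  case False
  then have "f (of_real b) = 0" using b by auto
  moreover have "J \<ge> 0"
    using divide_nonneg_pos[OF order_trans[OF circle_integral_nonneg J[of "1/2"]], of "2 * pi"] by simp
  ultimately show ?thesis using b p by (simp add: power_le_one)
next
  case True
  have b2: "b\<^sup>2 < 1" using b by (simp add: power_less_one_iff)
  obtain R where R: "\<And>j. 0 < R j" "\<And>j. R j < 1" "R \<longlonglongrightarrow> 1" "\<And>j z. norm z = R j \<Longrightarrow> f z \<noteq> 0"
    by (rule good_radii[OF f True]) (rule that)
  have le: "norm (f (of_real (R j * b))) powr p \<le> J / (1 - b\<^sup>2)" for j
  proof -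
    define g where "g z = f (of_real (R j) * z)" for z
    have g: "g holomorphic_on ball 0 (1 / R j)" "1 / R j > 1"
      unfolding g_def using R(1,2)[of j] by (auto intro!: holomorphic_dilation f)
    have gnz: "g z \<noteq> 0" if "norm z = 1" for z
      unfolding g_def using R(1)[of j] that by (intro R(4)[of _ j]) (simp add: norm_mult)
    obtain A :: "nat \<Rightarrow> complex" where A: "summable (\<lambda>k. norm (A k))"
      "\<And>z. norm z = 1 \<Longrightarrow> (norm (\<Sum>k. A k * z ^ k))\<^sup>2 = norm (g z) powr p"
      "\<And>z. norm z < 1 \<Longrightarrow> p > 0 \<Longrightarrow> norm (g z) powr p \<le> (norm (\<Sum>k. A k * z ^ k))\<^sup>2"
      by (rule powr_majorant_power_series[where p = p, OF g]) (erule gnz, rule that)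
    define S where "S = (\<Sum>k. (norm (A k))\<^sup>2)"
    note sm2 = summable_norm_square[OF A(1)]
    have "2 * pi * S = circle_integral p f (R j)"
      using integral_unique[OF parseval_circle[OF A(1)]] A(2)
      by (simp add: S_def circle_integral_def g_def)
    then have "2 * pi * S \<le> 2 * pi * J" using J[OF R(1,2)[of j]] by (simp only:)
    then have S: "S \<le> J" by simp
    have S0: "S \<ge> 0" unfolding S_def by (intro suminf_nonneg sm2) auto
    have geo: "(\<lambda>k. (b ^ k)\<^sup>2) sums (1 / (1 - b\<^sup>2))"
      using geometric_sums[of "b\<^sup>2"] b2 by (simp add: power_mult[symmetric] mult.commute)
    have sA: "summable (\<lambda>k. norm (A k) * b ^ k)"
      by (rule summable_comparison_test'[OF A(1), of 0])
         (use b in \<open>auto intro!: mult_left_le power_le_one\<close>)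
    have fin: "(\<Sum>k<n. norm (A k) * b ^ k)\<^sup>2 \<le> J / (1 - b\<^sup>2)" for n
    proof -
      have "(\<Sum>k<n. norm (A k) * b ^ k)\<^sup>2 \<le> (\<Sum>k<n. (norm (A k))\<^sup>2) * (\<Sum>k<n. (b ^ k)\<^sup>2)"
        by (rule Cauchy_Schwarz_ineq_sum)
      also have "\<dots> \<le> S * (1 / (1 - b\<^sup>2))"
      proof (rule mult_mono)
        show "(\<Sum>k<n. (norm (A k))\<^sup>2) \<le> S" unfolding S_def by (intro sum_le_suminf sm2) auto
        show "(\<Sum>k<n. (b ^ k)\<^sup>2) \<le> 1 / (1 - b\<^sup>2)"
          using sum_le_suminf[OF sums_summable[OF geo], of "{..<n}"] sums_unique[OF geo] by simp
      qed (auto simp: S0 intro: sum_nonneg)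
      also have "\<dots> \<le> J * (1 / (1 - b\<^sup>2))" using S b2 by (intro mult_right_mono) auto
      finally show ?thesis by simp
    qed
    have "(\<Sum>k. norm (A k) * b ^ k)\<^sup>2 \<le> J / (1 - b\<^sup>2)"
      by (rule LIMSEQ_le_const2[OF tendsto_power[OF summable_LIMSEQ[OF sA]]]) (use fin in auto)
    moreover have "norm (\<Sum>k. A k * of_real b ^ k) \<le> (\<Sum>k. norm (A k) * b ^ k)"
      using summable_norm[of "\<lambda>k. A k * of_real b ^ k"] sA b by (simp add: norm_mult norm_power)
    ultimately have "(norm (\<Sum>k. A k * of_real b ^ k))\<^sup>2 \<le> J / (1 - b\<^sup>2)"
      by (meson norm_ge_zero order_trans power_mono)
    moreover have "norm (g (of_real b)) powr p \<le> (norm (\<Sum>k. A k * of_real b ^ k))\<^sup>2"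
      using b p by (intro A(3)) auto
    ultimately show ?thesis by (simp add: g_def)
  qed
  have "isCont f (of_real b)"
    using b by (intro holomorphic_on_imp_continuous_on[OF f, THEN continuous_on_interior]) auto
  moreover have "(\<lambda>j. complex_of_real (R j * b)) \<longlonglongrightarrow> of_real (1 * b)"
    by (intro tendsto_intros R(3))
  ultimately have "(\<lambda>j. f (of_real (R j * b))) \<longlonglongrightarrow> f (of_real b)"
    using isCont_tendsto_compose by fastforce
  then have "(\<lambda>j. norm (f (of_real (R j * b))) powr p) \<longlonglongrightarrow> norm (f (of_real b)) powr p"
    using p by (intro tendsto_powr' tendsto_norm tendsto_const) auto
  then show ?thesis by (rule LIMSEQ_le_const2) (use le in auto)
qed

section \<open>Boundedness of the operator for a 2-Carleson measure\<close>

context carleson_2 begin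

lemma moment_bounds:
  shows moment_nonneg: "0 \<le> moment \<mu> n" and moment_le: "moment \<mu> n \<le> moment_const / (real (Suc n))\<^sup>2"
proof -
  show "0 \<le> moment \<mu> n" unfolding moment_def by (intro integral_nonneg_AE AE_I2) (auto simp: space_mu)
  have "integrable \<mu> (\<lambda>t. t ^ n)"
    by (rule integrable_mu_bounded[where B = 1]) (auto intro!: continuous_intros power_le_one simp: power_abs)
  then have "ennreal (moment \<mu> n) = (\<integral>\<^sup>+ t. ennreal (t ^ n) \<partial>\<mu>)"
    unfolding moment_def by (intro nn_integral_eq_integral[symmetric] AE_I2) (auto simp: space_mu)
  also have "\<dots> \<le> ennreal (moment_const / (real (Suc n))\<^sup>2)" by (rule nn_integral_power_le)
  finally show "moment \<mu> n \<le> moment_const / (real (Suc n))\<^sup>2"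
    using moment_const_nonneg by (subst (asm) ennreal_le_iff) auto
qed

text \<open>A majorant free of \<open>n\<close>, so that one summable sequence dominates all the
  inner series.\<close>

lemma moment_add_le: "moment \<mu> (n + k) \<le> moment_const * (1 / (real (Suc k))\<^sup>2)"
proof -
  have "moment \<mu> (n + k) \<le> moment_const / (real (Suc (n + k)))\<^sup>2" by (rule moment_le)
  also have "\<dots> \<le> moment_const / (real (Suc k))\<^sup>2"
    using moment_const_nonneg by (intro divide_left_mono power_mono) auto
  finally show ?thesis by simp
qed

lemma summable_moment_majorant: "summable (\<lambda>k. moment_const * (1 / (real (Suc k))\<^sup>2))"
proof -
  have "summable (\<lambda>k. inverse ((real (Suc k))\<^sup>2))"
    using inverse_power_summable[of 2, where 'a = real] by (subst summable_Suc_iff) simp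
  then show ?thesis by (intro summable_mult) (simp add: divide_inverse)
qed

definition moment_sum :: real where
  "moment_sum = (\<Sum>k. moment_const * (1 / (real (Suc k))\<^sup>2))"

lemma norm_moment_coeff_le:
  assumes "norm a \<le> B"
  shows "norm (complex_of_real (moment \<mu> (n + k)) * a) \<le> moment_const * (1 / (real (Suc k))\<^sup>2) * B"
proof -
  have "norm (complex_of_real (moment \<mu> (n + k)) * a) = moment \<mu> (n + k) * norm a"
    by (simp add: norm_mult moment_nonneg)
  also have "\<dots> \<le> moment_const * (1 / (real (Suc k))\<^sup>2) * B"
    using assms moment_const_nonneg by (intro mult_mono moment_add_le) auto
  finally show ?thesis .
qed

lemma norm_moment_sum_le:
  assumes B: "\<And>k. norm (a k :: complex) \<le> B"
  shows "norm (\<Sum>k. of_real (moment \<mu> (n + k)) * a k) \<le> moment_sum * B"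
proof -
  have sm: "summable (\<lambda>k. moment_const * (1 / (real (Suc k))\<^sup>2) * B)"
    by (intro summable_mult2 summable_moment_majorant)
  have sn: "summable (\<lambda>k. norm (of_real (moment \<mu> (n + k)) * a k))"
    by (rule summable_comparison_test'[OF sm, of 0]) (use norm_moment_coeff_le[OF B] in auto)
  have "norm (\<Sum>k. of_real (moment \<mu> (n + k)) * a k) \<le> (\<Sum>k. moment_const * (1 / (real (Suc k))\<^sup>2) * B)"
    by (rule order_trans[OF summable_norm[OF sn] suminf_le[OF norm_moment_coeff_le[OF B] sn sm]])
  also have "\<dots> = moment_sum * B"
    unfolding moment_sum_def by (rule suminf_mult2[symmetric, OF summable_moment_majorant])
  finally show ?thesis .
qed

lemma norm_DH_term_le:
  assumes B: "\<And>k. norm (a k :: complex) \<le> B"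
  shows "norm (of_nat (n + 1) * (\<Sum>k. of_real (moment \<mu> (n + k)) * a k) * z ^ n)
    \<le> moment_sum * B * (real (Suc n) * norm z ^ n)"
proof -
  have "norm (of_nat (n + 1) * (\<Sum>k. of_real (moment \<mu> (n + k)) * a k) * z ^ n)
      = real (Suc n) * norm (\<Sum>k. of_real (moment \<mu> (n + k)) * a k) * norm z ^ n"
    by (simp add: norm_mult norm_power del: of_nat_Suc of_nat_add)
  also have "\<dots> \<le> real (Suc n) * (moment_sum * B) * norm z ^ n"
    by (intro mult_right_mono mult_left_mono norm_moment_sum_le B) auto
  finally show ?thesis by (simp add: mult_ac)
qed

lemma summable_DH_majorant:
  assumes "norm (z::complex) < 1"
  shows "summable (\<lambda>n. K * (real (Suc n) * norm z ^ n))"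
  using geometric_deriv_sums[of "norm z"] assms by (intro summable_mult) (auto simp: sums_iff)

text \<open>Bounded Taylor coefficients bound the inner sums uniformly in \<open>n\<close>, and the
  outer series compares with the sum of (n + 1) |z|^n.\<close>

lemma holomorphic_DH:
  assumes B: "\<And>k. norm (taylor_coeff f k) \<le> B"
  shows "DH \<mu> f holomorphic_on ball 0 1"
proof (rule power_series_holomorphic)
  fix z :: complex assume "z \<in> ball 0 1"
  then have z: "norm z < 1" by simp
  have "summable (\<lambda>n. of_nat (n + 1) * (\<Sum>k. of_real (moment \<mu> (n + k)) * taylor_coeff f k) * z ^ n)"
    by (rule summable_comparison_test'[OF summable_DH_majorant[OF z], of 0])
       (rule norm_DH_term_le[OF B])
  then show "(\<lambda>n. (of_nat (n + 1) * (\<Sum>k. of_real (moment \<mu> (n + k)) * taylor_coeff f k)) * (z - 0) ^ n) sums DH \<mu> f z"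
    unfolding DH_def by (simp add: summable_sums)
qed

text \<open>Tannery's theorem is applied twice, to the inner series with the moment majorant and to
  the outer one with (n + 1) |z|^n. Dilation multiplies the k-th coefficient by
  \<open>R j ^ k\<close> and so preserves the bound \<open>B\<close>.\<close>

lemma DH_dilation_tendsto:
  assumes f: "f holomorphic_on ball 0 1" and B: "\<And>k. norm (taylor_coeff f k) \<le> B"
    and R: "\<And>j. 0 < R j" "\<And>j. R j < 1" "R \<longlonglongrightarrow> 1" and z: "norm z < 1"
  shows "(\<lambda>j. DH \<mu> (\<lambda>z. f (of_real (R j) * z)) z) \<longlonglongrightarrow> DH \<mu> f z"
proof -
  define a where "a j k = of_real (R j) ^ k * taylor_coeff f k" for j k
  have aB: "norm (a j k) \<le> B" for j k
  proof -
    have "norm (a j k) = R j ^ k * norm (taylor_coeff f k)"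
      using R(1)[of j] by (simp add: a_def norm_mult norm_power)
    also have "\<dots> \<le> 1 * norm (taylor_coeff f k)"
      using R(1,2)[of j] by (intro mult_right_mono power_le_one) auto
    finally show ?thesis using B[of k] by simp
  qed
  have a_lim: "(\<lambda>j. a j k) \<longlonglongrightarrow> taylor_coeff f k" for k
  proof -
    have "(\<lambda>j. a j k) \<longlonglongrightarrow> of_real 1 ^ k * taylor_coeff f k"
      unfolding a_def by (intro tendsto_intros R(3))
    then show ?thesis by simp
  qed
  have c_lim: "(\<lambda>j. \<Sum>k. of_real (moment \<mu> (n + k)) * a j k) \<longlonglongrightarrow> (\<Sum>k. of_real (moment \<mu> (n + k)) * taylor_coeff f k)" for n
  proof (rule tannerys_theorem[THEN conjunct2, THEN conjunct2])
    show "(\<lambda>j. of_real (moment \<mu> (n + k)) * a j k) \<longlonglongrightarrow> of_real (moment \<mu> (n + k)) * taylor_coeff f k" for k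
      by (intro tendsto_intros a_lim)
    show "eventually (\<lambda>(k, j). norm (of_real (moment \<mu> (n + k)) * a j k) \<le> moment_const * (1 / (real (Suc k))\<^sup>2) * B) (at_top \<times>\<^sub>F sequentially)"
      using norm_moment_coeff_le[OF aB] by (intro always_eventually) auto
    show "summable (\<lambda>k. moment_const * (1 / (real (Suc k))\<^sup>2) * B)"
      by (intro summable_mult2 summable_moment_majorant)
  qed auto
  have "(\<lambda>j. \<Sum>n. of_nat (n + 1) * (\<Sum>k. of_real (moment \<mu> (n + k)) * a j k) * z ^ n) \<longlonglongrightarrow> DH \<mu> f z"
    unfolding DH_def
  proof (rule tannerys_theorem[THEN conjunct2, THEN conjunct2])
    show "(\<lambda>j. of_nat (n + 1) * (\<Sum>k. of_real (moment \<mu> (n + k)) * a j k) * z ^ n)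
        \<longlonglongrightarrow> of_nat (n + 1) * (\<Sum>k. of_real (moment \<mu> (n + k)) * taylor_coeff f k) * z ^ n" for n
      by (intro tendsto_intros c_lim)
    show "eventually (\<lambda>(n, j). norm (of_nat (n + 1) * (\<Sum>k. of_real (moment \<mu> (n + k)) * a j k) * z ^ n)
        \<le> moment_sum * B * (real (Suc n) * norm z ^ n)) (at_top \<times>\<^sub>F sequentially)"
      by (rule always_eventually) (simp only: split_paired_All prod.case, intro allI norm_DH_term_le aB)
    show "summable (\<lambda>n. moment_sum * B * (real (Suc n) * norm z ^ n))" by (rule summable_DH_majorant[OF z])
  qed simp
  moreover have "DH \<mu> (\<lambda>z. f (of_real (R j) * z)) z = (\<Sum>n. of_nat (n + 1) * (\<Sum>k. of_real (moment \<mu> (n + k)) * a j k) * z ^ n)" for j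
    unfolding DH_def a_def by (simp only: taylor_coeff_dilation[OF f R(1,2)])
  ultimately show ?thesis by simp
qed

lemma DH_bounded:
  assumes p: "1 \<le> p" "p \<le> 2" and f: "f holomorphic_on ball 0 1"
    and N: "\<And>r. 0 < r \<Longrightarrow> r < 1 \<Longrightarrow> circle_integral p f r \<le> 2 * pi * N" and N0: "0 \<le> N"
  shows "DH \<mu> f holomorphic_on ball 0 1"
    and "0 < r \<Longrightarrow> r < 1 \<Longrightarrow> circle_integral p (DH \<mu> f) r \<le> bound_const p * (2 * pi * N)"
proof -
  have B: "norm (taylor_coeff f k) \<le> 1 + N" for k
    using norm_taylor_coeff_le[OF f p(1) N] by blast
  show hol: "DH \<mu> f holomorphic_on ball 0 1" by (rule holomorphic_DH[OF B])
  assume r: "0 < r" "r < 1"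
  define K where "K = bound_const p * (2 * pi * N)"
  have K: "K \<ge> 0" using bound_const_nonneg N0 by (simp add: K_def)
  show "circle_integral p (DH \<mu> f) r \<le> bound_const p * (2 * pi * N)"
  proof (cases "\<exists>z\<in>ball 0 1. f z \<noteq> 0")
    \<comment> \<open>A function vanishing on the disc has no good radii; its coefficients are zero
      by the Fourier formula on the circle of radius 1/2.\<close>
    case False
    have "taylor_coeff f k = 0" for k
    proof -
      have "((\<lambda>\<theta>. cis (- real k * \<theta>) * f (of_real (1/2) * cis \<theta>)) has_integral 0) {0..2 * pi}"
        using False by (intro has_integral_is_0) (auto simp: norm_mult)
      from has_integral_unique[OF this coefficient_disc[OF f, of "1/2" k]] show ?thesis by simp
    qed
    then have "DH \<mu> f z = 0" for z by (simp add: DH_def)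
    then show ?thesis using K p by (simp add: circle_integral_def K_def)
  next
    case True
    obtain R where R: "\<And>j. 0 < R j" "\<And>j. R j < 1" "R \<longlonglongrightarrow> 1" "\<And>j z. norm z = R j \<Longrightarrow> f z \<noteq> 0"
      by (rule good_radii[OF f True]) (rule that)
    define g where "g j z = f (of_real (R j) * z)" for j z
    have holDHg: "DH \<mu> (g j) holomorphic_on ball 0 1" for j
    proof (rule holomorphic_DH)
      fix k
      have "norm (taylor_coeff (g j) k) = R j ^ k * norm (taylor_coeff f k)"
        unfolding g_def using R(1)[of j] by (simp add: taylor_coeff_dilation[OF f R(1,2)] norm_mult norm_power)
      also have "\<dots> \<le> 1 * norm (taylor_coeff f k)"
        using R(1,2)[of j] by (intro mult_right_mono power_le_one) auto
      finally show "norm (taylor_coeff (g j) k) \<le> 1 + N" using B[of k] by simp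
    qed
    define h where "h j \<theta> = ennreal (norm (DH \<mu> (g j) (of_real r * cis \<theta>)) powr p) * indicator {0..2 * pi} \<theta>" for j \<theta>
    have [measurable]: "h j \<in> borel_measurable lborel" for j
    proof -
      have m: "(\<lambda>\<theta>. norm (DH \<mu> (g j) (of_real r * cis \<theta>)) powr p) \<in> borel_measurable borel"
        using p r by (intro borel_measurable_continuous_onI continuous_on_circle_powr holDHg) auto
      show ?thesis unfolding h_def[abs_def]
        by (intro borel_measurable_times_ennreal borel_measurable_indicator
            measurable_compose[OF _ measurable_ennreal]) (use m in auto)
    qed
    \<comment> \<open>The bound is uniform in \<open>j\<close> because \<open>N\<close> controls the
      mean of \<open>f\<close> on every circle.\<close>
    have hK: "(\<integral>\<^sup>+ \<theta>. h j \<theta> \<partial>lborel) \<le> ennreal K" for j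
    proof -
      have "(\<integral>\<^sup>+ \<theta>. h j \<theta> \<partial>lborel) \<le> ennreal (bound_const p * integral {0..2 * pi} (\<lambda>\<theta>. norm (g j (cis \<theta>)) powr p))"
        unfolding h_def
      proof (rule nn_integral_DH_le)
        show "g j holomorphic_on ball 0 (1 / R j)" "1 / R j > 1"
          unfolding g_def using R(1,2)[of j] by (auto intro!: holomorphic_dilation f)
        show "g j z \<noteq> 0" if "norm z = 1" for z
          unfolding g_def using R(1)[of j] that by (intro R(4)[of _ j]) (simp add: norm_mult)
      qed (use r p in auto)
      also have "integral {0..2 * pi} (\<lambda>\<theta>. norm (g j (cis \<theta>)) powr p) = circle_integral p f (R j)"
        by (simp add: g_def circle_integral_def)
      also have "ennreal (bound_const p * circle_integral p f (R j)) \<le> ennreal K"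
        unfolding K_def using N[OF R(1,2)] bound_const_nonneg by (intro ennreal_leI mult_left_mono) auto
      finally show ?thesis .
    qed
    have lim: "(\<lambda>j. h j \<theta>) \<longlonglongrightarrow> ennreal (norm (DH \<mu> f (of_real r * cis \<theta>)) powr p) * indicator {0..2 * pi} \<theta>" for \<theta>
    proof (cases "\<theta> \<in> {0..2 * pi}")
      case True
      have "(\<lambda>j. DH \<mu> (g j) (of_real r * cis \<theta>)) \<longlonglongrightarrow> DH \<mu> f (of_real r * cis \<theta>)"
        unfolding g_def by (rule DH_dilation_tendsto[OF f B R(1-3)]) (use r in \<open>simp add: norm_mult\<close>)
      then have "(\<lambda>j. ennreal (norm (DH \<mu> (g j) (of_real r * cis \<theta>)) powr p)) \<longlonglongrightarrow> ennreal (norm (DH \<mu> f (of_real r * cis \<theta>)) powr p)"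
        using p by (intro tendsto_ennrealI tendsto_powr' tendsto_norm tendsto_const) auto
      then show ?thesis using True by (simp add: h_def)
    qed (simp add: h_def)
    have "((\<lambda>\<theta>. norm (DH \<mu> f (of_real r * cis \<theta>)) powr p) has_integral circle_integral p (DH \<mu> f) r) {0..2 * pi}"
      unfolding circle_integral_def using p r
      by (intro integrable_integral integrable_continuous_interval continuous_on_circle_powr hol) auto
    then have "ennreal (circle_integral p (DH \<mu> f) r)
        = (\<integral>\<^sup>+ \<theta>. ennreal (norm (DH \<mu> f (of_real r * cis \<theta>)) powr p) * indicator {0..2 * pi} \<theta> \<partial>lborel)"
      by (intro nn_integral_has_integral_lebesgue'[symmetric]) auto
    also have "\<dots> = (\<integral>\<^sup>+ \<theta>. liminf (\<lambda>j. h j \<theta>) \<partial>lborel)"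
      using lim_imp_Liminf[OF sequentially_bot lim] by simp
    also have "\<dots> \<le> liminf (\<lambda>j. \<integral>\<^sup>+ \<theta>. h j \<theta> \<partial>lborel)"
      by (rule nn_integral_liminf) simp
    also have "\<dots> \<le> ennreal K"
      by (rule order_trans[OF Liminf_mono[of _ "\<lambda>_. ennreal K"]]) (use hK in \<open>auto simp: Liminf_const\<close>)
    finally show ?thesis using K unfolding K_def by (subst (asm) ennreal_le_iff) auto
  qed
qed

end

lemma hardy_space_normE:
  assumes "f \<in> hardy_space p" "p > 0"
  obtains N where "N \<ge> 0" "hardy_norm p f = ennreal N"
    "\<And>r. 0 < r \<Longrightarrow> r < 1 \<Longrightarrow> circle_integral p f r \<le> 2 * pi * N powr p"
proof -
  have "hardy_norm p f < \<infinity>" using assms by (simp add: hardy_space_def)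
  then obtain N where N: "N \<ge> 0" "hardy_norm p f = ennreal N"
    by (cases "hardy_norm p f" rule: ennreal_cases) auto
  then show ?thesis
    using that[OF N] hardy_norm_le_iff[OF assms(2) N(1), of f] by auto
qed

lemma (in carleson_2) bounded_on_hardy_DH:
  assumes p: "1 \<le> p" "p \<le> 2"
  shows "bounded_on_hardy p p (DH \<mu>)"
proof -
  define D where "D = bound_const p powr (1 / p)"
  have *: "DH \<mu> f holomorphic_on ball 0 1 \<and> hardy_norm p (DH \<mu> f) \<le> ennreal D * hardy_norm p f
      \<and> hardy_norm p f < \<infinity>" if f: "f \<in> hardy_space p" for f
  proof -
    obtain N where N: "N \<ge> 0" "hardy_norm p f = ennreal N"
      "\<And>r. 0 < r \<Longrightarrow> r < 1 \<Longrightarrow> circle_integral p f r \<le> 2 * pi * N powr p"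
      using hardy_space_normE[OF f] p by auto
    have hol: "f holomorphic_on ball 0 1" using f by (simp add: hardy_space_def)
    note b = DH_bounded[OF p hol N(3)]
    have "(D * N) powr p = bound_const p * N powr p"
      using N(1) bound_const_nonneg p by (simp add: D_def powr_mult powr_powr)
    then have "hardy_norm p (DH \<mu> f) \<le> ennreal (D * N)"
      using b(2) p N(1) by (subst hardy_norm_le_iff) (auto simp: D_def mult_ac)
    then show ?thesis using b(1) N by (simp add: ennreal_mult D_def)
  qed
  show ?thesis
    unfolding bounded_on_hardy_def
  proof (intro conjI exI[of _ D] ballI)
    show "D \<ge> 0" by (simp add: D_def)
    fix f assume f: "f \<in> hardy_space p"
    show "hardy_norm p (DH \<mu> f) \<le> ennreal D * hardy_norm p f" using *[OF f] by blast
    moreover have "ennreal D * hardy_norm p f < \<infinity>"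
      using *[OF f] by (simp add: ennreal_mult_less_top)
    ultimately have "hardy_norm p (DH \<mu> f) < \<infinity>" by (rule le_less_trans)
    then show "DH \<mu> f \<in> hardy_space p" using *[OF f] by (simp add: hardy_space_def)
  qed
qed

section \<open>Necessity of the Carleson condition\<close>

text \<open>The Taylor coefficients (k + 1) b^k are nonnegative for b \<ge> 0, so the series of
  \<open>DH\<close> at z = b has no cancellation. The function is not normalised; its norm is
  carried as a power of 1 - b.\<close>

definition test_fun :: "real \<Rightarrow> complex \<Rightarrow> complex" where
  "test_fun b z = 1 / (1 - of_real b * z)\<^sup>2"

lemma test_fun_sums:
  assumes "0 \<le> b" "b < 1" "norm z \<le> 1"
  shows "(\<lambda>k. of_real (real (Suc k) * b ^ k) * z ^ k) sums test_fun b z"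
proof -
  have "b * norm z \<le> b * 1" using assms by (intro mult_left_mono) auto
  then have "norm (of_real b * z) < 1" using assms by (simp add: norm_mult)
  from geometric_deriv_sums[OF this] show ?thesis
    by (simp add: test_fun_def power_mult_distrib mult_ac)
qed

lemma holomorphic_test_fun:
  assumes "0 \<le> b" "b < 1"
  shows "test_fun b holomorphic_on ball 0 1"
proof -
  have "1 - of_real b * z \<noteq> 0" if "norm z < 1" for z :: complex
  proof -
    have "1 - b \<le> norm (1 - of_real b * z)"
      using assms that by (intro norm_one_minus_le_norm_one_minus_mult) auto
    then show ?thesis using assms by auto
  qed
  then show ?thesis unfolding test_fun_def by (intro holomorphic_intros) auto
qed

lemma taylor_coeff_test_fun:
  assumes "0 \<le> b" "b < 1"
  shows "taylor_coeff (test_fun b) k = of_real (real (Suc k) * b ^ k)"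
proof -
  \<comment> \<open>The coefficients are read off on the circle of radius 1/2, where the explicit
    series and \<open>taylor_coeff\<close> must give the same Fourier coefficient.\<close>
  define A where "A k = complex_of_real (real (Suc k) * b ^ k) * of_real (1/2) ^ k" for k
  have "norm (A k) = real (Suc k) * (b / 2) ^ k" for k
  proof -
    have "A k = of_real (real (Suc k) * (b / 2) ^ k)" by (simp add: A_def power_divide)
    then show ?thesis using assms by (simp only: norm_of_real abs_of_nonneg) simp
  qed
  moreover have "summable (\<lambda>k. real (Suc k) * (b / 2) ^ k)"
    using geometric_deriv_sums[of "b / 2"] assms by (auto simp: sums_iff)
  ultimately have sA: "summable (\<lambda>k. norm (A k))" by simp
  have "(\<Sum>j. A j * cis \<theta> ^ j) = test_fun b (of_real (1/2) * cis \<theta>)" for \<theta>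
  proof -
    have "A j * cis \<theta> ^ j = of_real (real (Suc j) * b ^ j) * (of_real (1/2) * cis \<theta>) ^ j" for j
      by (simp only: A_def power_mult_distrib mult.assoc)
    moreover have "norm (of_real (1/2) * cis \<theta>) \<le> 1" by (simp add: norm_mult)
    ultimately show ?thesis
      using test_fun_sums[OF assms, of "of_real (1/2) * cis \<theta>"] by (simp only: sums_iff)
  qed
  with coefficient_circle[OF sA, of k]
  have "((\<lambda>\<theta>. cis (- real k * \<theta>) * test_fun b (of_real (1/2) * cis \<theta>)) has_integral 2 * pi * A k) {0..2 * pi}"
    by simp
  from has_integral_unique[OF this coefficient_disc[OF holomorphic_test_fun[OF assms], of "1/2" k]]
  show ?thesis by (simp add: A_def)
qed

text \<open>With w = 1 - b r cis \<theta>, |w|^(-2 p) is |w|^(2 - 2 p) times |w|^(-2). The first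
  factor has a nonpositive exponent and |w| \<ge> 1 - b; the second is the squared modulus of a
  geometric series, integrated exactly by Parseval's identity.\<close>

lemma circle_integral_test_fun_le:
  assumes b: "0 \<le> b" "b < 1" and r: "0 < r" "r < 1" and p: "1 \<le> p"
  shows "circle_integral p (test_fun b) r \<le> 2 * pi * (1 - b) powr (1 - 2 * p)"
proof -
  define w where "w \<theta> = 1 - of_real (b * r) * cis \<theta>" for \<theta>
  have br: "0 \<le> b * r" "b * r \<le> b" "b * r < 1"
  proof -
    show "0 \<le> b * r" using b r by simp
    show "b * r \<le> b" using b r by (intro mult_left_le) auto
    then show "b * r < 1" using b by simp
  qed
  have w: "1 - b \<le> norm (w \<theta>)" for \<theta>
    using norm_one_minus_le_norm_one_minus_mult(1)[of "cis \<theta>" "b * r"] br unfolding w_def by auto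
  define A where "A k = complex_of_real ((b * r) ^ k)" for k
  have nA: "norm (A k) = (b * r) ^ k" for k
    unfolding A_def norm_of_real using br(1) by (intro abs_of_nonneg zero_le_power)
  have sA: "summable (\<lambda>k. norm (A k))" unfolding nA using br by (intro summable_geometric) auto
  have "(\<Sum>k. A k * cis \<theta> ^ k) = 1 / w \<theta>" for \<theta>
  proof -
    have "norm (of_real (b * r) * cis \<theta>) < 1" using br by (simp add: norm_mult)
    from geometric_sums[OF this] show ?thesis
      by (simp add: A_def w_def sums_iff power_mult_distrib mult_ac)
  qed
  moreover have "(\<Sum>k. (norm (A k))\<^sup>2) = 1 / (1 - (b * r)\<^sup>2)"
  proof -
    have "(\<Sum>k. (norm (A k))\<^sup>2) = (\<Sum>k. ((b * r)\<^sup>2) ^ k)"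
      by (simp add: nA power_mult[symmetric] mult.commute)
    also have "\<dots> = 1 / (1 - (b * r)\<^sup>2)"
      using br by (intro suminf_geometric) (simp add: abs_square_less_1)
    finally show ?thesis .
  qed
  ultimately have P: "((\<lambda>\<theta>. (norm (1 / w \<theta>))\<^sup>2) has_integral 2 * pi * (1 / (1 - (b * r)\<^sup>2))) {0..2 * pi}"
    using parseval_circle[OF sA] by simp
  have "circle_integral p (test_fun b) r \<le> (1 - b) powr (2 - 2 * p) * (2 * pi * (1 / (1 - (b * r)\<^sup>2)))"
  proof (rule has_integral_le)
    show "((\<lambda>\<theta>. norm (test_fun b (of_real r * cis \<theta>)) powr p) has_integral circle_integral p (test_fun b) r) {0..2 * pi}"
      unfolding circle_integral_def using p r
      by (intro integrable_integral integrable_continuous_interval continuous_on_circle_powr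
          holomorphic_test_fun b) auto
    show "((\<lambda>\<theta>. (1 - b) powr (2 - 2 * p) * (norm (1 / w \<theta>))\<^sup>2) has_integral
        (1 - b) powr (2 - 2 * p) * (2 * pi * (1 / (1 - (b * r)\<^sup>2)))) {0..2 * pi}"
      by (intro has_integral_mult_right P)
    fix \<theta>
    define n where "n = norm (w \<theta>)"
    have n: "1 - b \<le> n" "n > 0" using w[of \<theta>] b by (auto simp: n_def)
    have "norm (test_fun b (of_real r * cis \<theta>)) = 1 / n\<^sup>2"
      by (simp add: test_fun_def n_def w_def norm_divide norm_power mult.assoc)
    then have "norm (test_fun b (of_real r * cis \<theta>)) = n powr (-2)"
      using n by (simp add: powr_minus divide_inverse powr_numeral)
    then have "norm (test_fun b (of_real r * cis \<theta>)) powr p = n powr (2 - 2 * p) * n powr (-2)"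
      by (simp only: powr_powr flip: powr_add) simp
    also have "\<dots> \<le> (1 - b) powr (2 - 2 * p) * n powr (-2)"
      using n b p by (intro mult_right_mono powr_mono2') auto
    also have "n powr (-2) = (norm (1 / w \<theta>))\<^sup>2"
      using n by (simp add: powr_minus divide_inverse powr_numeral n_def norm_inverse power_inverse)
    finally show "norm (test_fun b (of_real r * cis \<theta>)) powr p \<le> (1 - b) powr (2 - 2 * p) * (norm (1 / w \<theta>))\<^sup>2" .
  qed
  also have "\<dots> \<le> (1 - b) powr (2 - 2 * p) * (2 * pi * (1 / (1 - b)))"
  proof -
    have "(b * r)\<^sup>2 \<le> b * r" using br by (simp add: power2_eq_square mult_left_le)
    then have "1 / (1 - (b * r)\<^sup>2) \<le> 1 / (1 - b)" using br b by (intro divide_left_mono) auto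
    then show ?thesis by (intro mult_left_mono) auto
  qed
  also have "\<dots> = 2 * pi * ((1 - b) powr (2 - 2 * p) * (1 - b) powr (-1))"
    using b by (simp add: powr_minus divide_inverse)
  also have "(1 - b) powr (2 - 2 * p) * (1 - b) powr (-1) = (1 - b) powr (1 - 2 * p)"
    by (subst powr_add[symmetric]) simp
  finally show ?thesis .
qed

text \<open>All terms are nonnegative, and \<open>moment \<mu> (n + k)\<close> is at least b^(n + k)
  times the mass of [b, 1). The minorant is then a product of two copies of the sum of (k + 1) b^(2
  k), each equal to (1 - b^2)^(-2). The total mass \<open>T\<close> supplies convergence.\<close>

lemma (in borel_01) norm_DH_test_fun_ge:
  assumes fin: "finite_measure \<mu>" and b: "0 \<le> b" "b < 1"
  shows "measure \<mu> {b..<1} / (1 - b\<^sup>2) ^ 4 \<le> norm (DH \<mu> (test_fun b) (of_real b))"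
proof -
  interpret finite_measure \<mu> by (rule fin)
  define m T where "m = measure \<mu> {b..<1}" and "T = measure \<mu> (space \<mu>)"
  have b2: "b\<^sup>2 < 1" using b by (simp add: abs_square_less_1)
  have m0: "m \<ge> 0" by (simp add: m_def)
  have int: "integrable \<mu> (\<lambda>t. t ^ n)" for n
    by (rule integrable_const_bound[of _ 1]) (auto intro!: AE_I2 power_le_one simp: space_mu power_abs)
  have lower: "b ^ n * m \<le> moment \<mu> n" for n
  proof -
    have "(\<integral>t. b ^ n * indicator {b..<1} t \<partial>\<mu>) \<le> (\<integral>t. t ^ n \<partial>\<mu>)"
    proof (rule integral_mono[OF _ int])
      show "integrable \<mu> (\<lambda>t. b ^ n * indicator {b..<1} t)"
        using tail_sets[OF b(1)] by (intro integrable_mult_right integrable_real_indicator) (auto simp: emeasure_eq_measure)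
      show "b ^ n * indicator {b..<1} t \<le> t ^ n" if "t \<in> space \<mu>" for t
        using that b by (auto simp: space_mu indicator_def intro: power_mono)
    qed
    then show ?thesis using tail_sets[OF b(1)] by (simp add: moment_def m_def)
  qed
  have upper: "moment \<mu> n \<le> T" for n
  proof -
    have "(\<integral>t. t ^ n \<partial>\<mu>) \<le> (\<integral>t. 1 \<partial>\<mu>)"
      by (intro integral_mono int) (auto simp: space_mu power_le_one)
    then show ?thesis by (simp add: moment_def T_def)
  qed
  have nonneg: "0 \<le> moment \<mu> n" for n
    using lower[of n] b m0 by (meson mult_nonneg_nonneg order_trans zero_le_power)
  have geo: "(\<lambda>k. real (Suc k) * q ^ k) sums (1 / (1 - q)\<^sup>2)" if "0 \<le> q" "q < 1" for q :: real
    using geometric_deriv_sums[of q] that by simp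
  define u where "u n k = moment \<mu> (n + k) * (real (Suc k) * b ^ k)" for n k
  have u0: "0 \<le> u n k" for n k using nonneg b by (simp add: u_def)
  have sT: "(\<lambda>k. T * (real (Suc k) * b ^ k)) sums (T * (1 / (1 - b)\<^sup>2))"
    by (intro sums_mult geo b)
  have uT: "u n k \<le> T * (real (Suc k) * b ^ k)" for n k
    unfolding u_def using upper b by (intro mult_right_mono) auto
  have su: "summable (u n)" for n
    by (rule summable_comparison_test'[OF sums_summable[OF sT], of 0]) (use uT u0 in auto)
  define c where "c n = (\<Sum>k. u n k)" for n
  have c0: "0 \<le> c n" for n unfolding c_def by (intro suminf_nonneg su u0)
  have cT: "c n \<le> T * (1 / (1 - b)\<^sup>2)" for n
    unfolding c_def using suminf_le[OF uT su sums_summable[OF sT]] sums_unique[OF sT] by simp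
  have cm: "b ^ n * m * (1 / (1 - b\<^sup>2)\<^sup>2) \<le> c n" for n
  proof -
    have s: "(\<lambda>k. b ^ n * m * (real (Suc k) * (b\<^sup>2) ^ k)) sums (b ^ n * m * (1 / (1 - b\<^sup>2)\<^sup>2))"
      by (intro sums_mult geo b2) simp
    have "b ^ n * m * (real (Suc k) * (b\<^sup>2) ^ k) \<le> u n k" for k
    proof -
      have "b ^ n * m * (real (Suc k) * (b\<^sup>2) ^ k) = (b ^ (n + k) * m) * (real (Suc k) * b ^ k)"
        by (simp add: power_add power2_eq_square power_mult_distrib mult_ac)
      also have "\<dots> \<le> u n k"
        unfolding u_def using lower b by (intro mult_right_mono) auto
      finally show ?thesis .
    qed
    from suminf_le[OF this sums_summable[OF s] su] sums_unique[OF s] show ?thesis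
      by (simp add: c_def)
  qed
  have sB: "(\<lambda>n. T * (1 / (1 - b)\<^sup>2) * (real (Suc n) * b ^ n)) sums (T * (1 / (1 - b)\<^sup>2) * (1 / (1 - b)\<^sup>2))"
    by (intro sums_mult geo b)
  have sc: "summable (\<lambda>n. c n * (real (Suc n) * b ^ n))"
  proof (rule summable_comparison_test'[OF sums_summable[OF sB], of 0])
    show "norm (c n * (real (Suc n) * b ^ n)) \<le> T * (1 / (1 - b)\<^sup>2) * (real (Suc n) * b ^ n)" for n
    proof -
      have "norm (c n * (real (Suc n) * b ^ n)) = c n * (real (Suc n) * b ^ n)"
        using c0[of n] b by simp
      also have "\<dots> \<le> T * (1 / (1 - b)\<^sup>2) * (real (Suc n) * b ^ n)"
        by (rule mult_right_mono[OF cT]) (use b in simp)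
      finally show ?thesis .
    qed
  qed
  define S where "S = (\<Sum>n. c n * (real (Suc n) * b ^ n))"
  have "DH \<mu> (test_fun b) (of_real b) = of_real S"
  proof -
    have "(\<Sum>k. of_real (moment \<mu> (n + k)) * taylor_coeff (test_fun b) k) = complex_of_real (c n)" for n
      unfolding c_def suminf_of_real[OF su] taylor_coeff_test_fun[OF b] u_def of_real_mult ..
    then show ?thesis
      unfolding DH_def S_def suminf_of_real[OF sc] by (simp add: mult_ac)
  qed
  moreover have "m / (1 - b\<^sup>2) ^ 4 \<le> S"
  proof -
    have s: "(\<lambda>n. m * (1 / (1 - b\<^sup>2)\<^sup>2) * (real (Suc n) * (b\<^sup>2) ^ n)) sums (m * (1 / (1 - b\<^sup>2)\<^sup>2) * (1 / (1 - b\<^sup>2)\<^sup>2))"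
      by (intro sums_mult geo b2) simp
    have "m * (1 / (1 - b\<^sup>2)\<^sup>2) * (real (Suc n) * (b\<^sup>2) ^ n) \<le> c n * (real (Suc n) * b ^ n)" for n
    proof -
      have "m * (1 / (1 - b\<^sup>2)\<^sup>2) * (real (Suc n) * (b\<^sup>2) ^ n)
          = (b ^ n * m * (1 / (1 - b\<^sup>2)\<^sup>2)) * (real (Suc n) * b ^ n)"
        by (simp add: power2_eq_square power_mult_distrib mult_ac)
      also have "\<dots> \<le> c n * (real (Suc n) * b ^ n)"
        by (rule mult_right_mono[OF cm]) (use b in simp)
      finally show ?thesis .
    qed
    from suminf_le[OF this sums_summable[OF s] sc] sums_unique[OF s]
    have "m * (1 / (1 - b\<^sup>2)\<^sup>2) * (1 / (1 - b\<^sup>2)\<^sup>2) \<le> S" by (simp add: S_def)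
    moreover have "m * (1 / (1 - b\<^sup>2)\<^sup>2) * (1 / (1 - b\<^sup>2)\<^sup>2) = m / (1 - b\<^sup>2) ^ 4"
      by (simp add: power_numeral_reduce)
    ultimately show ?thesis by simp
  qed
  ultimately show ?thesis by (simp add: m_def)
qed

text \<open>In powers of y = 1 - b the exponent \<open>p\<close> cancels: the norm bound y^(1/p - 2)
  of the test function meets y^(-1/p) from the growth estimate and leaves y^(-2). Against the mass
  divided by (1 - b^2)^4, with 1 - b^2 \<le> 2 y, this gives 16 D y^2.\<close>

lemma (in borel_01) carleson_2_if_bounded_on_hardy:
  assumes fin: "finite_measure \<mu>" and p: "1 \<le> p" and bd: "bounded_on_hardy p p (DH \<mu>)"
  shows "carleson_measure 2 \<mu>"
proof -
  interpret finite_measure \<mu> by (rule fin)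
  obtain D where D: "D \<ge> 0" "\<And>f. f \<in> hardy_space p \<Longrightarrow> DH \<mu> f \<in> hardy_space p"
    "\<And>f. f \<in> hardy_space p \<Longrightarrow> hardy_norm p (DH \<mu> f) \<le> ennreal D * hardy_norm p f"
    using bd unfolding bounded_on_hardy_def by blast
  have m_le: "measure \<mu> {b..<1} \<le> 16 * D * (1 - b)\<^sup>2" if b: "0 \<le> b" "b < 1" for b
  proof -
    define y where "y = 1 - b"
    have y: "y > 0" using b by (simp add: y_def)
    define N where "N = y powr (1 / p - 2)"
    have "(1 / p - 2) * p = 1 - 2 * p" using p by (simp add: left_diff_distrib)
    then have "N powr p = y powr (1 - 2 * p)" by (simp only: N_def powr_powr)
    then have hn: "hardy_norm p (test_fun b) \<le> ennreal N"
      using p circle_integral_test_fun_le[OF b _ _ p]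
      by (subst hardy_norm_le_iff) (auto simp: N_def y_def)
    then have mem: "test_fun b \<in> hardy_space p"
      using holomorphic_test_fun[OF b] by (auto simp: hardy_space_def intro: le_less_trans)
    define g where "g = DH \<mu> (test_fun b)"
    have holg: "g holomorphic_on ball 0 1" using D(2)[OF mem] by (simp add: g_def hardy_space_def)
    have "hardy_norm p g \<le> ennreal D * ennreal N"
      unfolding g_def by (rule order_trans[OF D(3)[OF mem] mult_left_mono[OF hn]]) simp
    also have "\<dots> = ennreal (D * N)" using D(1) by (simp add: N_def ennreal_mult)
    finally have "circle_integral p g r \<le> 2 * pi * (D * N) powr p" if "0 < r" "r < 1" for r
      using that p D(1) by (subst (asm) hardy_norm_le_iff) (auto simp: N_def)
    from pointwise_bound[OF holg _ b this]
    have "norm (g (of_real b)) powr p \<le> (D * N) powr p / (1 - b\<^sup>2)" using p by simp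
    also have "\<dots> \<le> (D * N) powr p / y"
    proof -
      have "b\<^sup>2 \<le> b" using b by (simp add: power2_eq_square mult_left_le)
      then show ?thesis using y by (intro divide_left_mono) (auto simp: y_def)
    qed
    also have "\<dots> = (D * N) powr p * y powr (-1)" using y by (simp add: powr_minus divide_inverse)
    finally have "(norm (g (of_real b)) powr p) powr (1 / p) \<le> ((D * N) powr p * y powr (-1)) powr (1 / p)"
      using p by (intro powr_mono2) auto
    moreover have "((D * N) powr p * y powr (-1)) powr (1 / p) = ((D * N) powr p) powr (1 / p) * (y powr (-1)) powr (1 / p)"
      by (rule powr_mult)
    moreover have "((D * N) powr p) powr (1 / p) = D * N"
      using p D(1) by (simp add: powr_powr N_def)
    moreover have "(y powr (-1)) powr (1 / p) = y powr (- (1 / p))" by (simp only: powr_powr) simp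
    moreover have "(norm (g (of_real b)) powr p) powr (1 / p) = norm (g (of_real b))"
      using p by (simp add: powr_powr)
    ultimately have "norm (g (of_real b)) \<le> D * N * y powr (- (1 / p))" by (simp only:)
    also have "\<dots> = D * y powr (-2)"
      using p by (simp add: N_def mult.assoc flip: powr_add)
    also have "\<dots> = D / y\<^sup>2" using y by (simp add: powr_minus powr_numeral divide_inverse)
    finally have "measure \<mu> {b..<1} / (1 - b\<^sup>2) ^ 4 \<le> D / y\<^sup>2"
      using norm_DH_test_fun_ge[OF fin b] by (simp add: g_def)
    moreover have b2: "0 < 1 - b\<^sup>2" using b by (simp add: abs_square_less_1)
    ultimately have "measure \<mu> {b..<1} \<le> D / y\<^sup>2 * (1 - b\<^sup>2) ^ 4"
      by (simp add: divide_le_eq)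
    also have "\<dots> \<le> D / y\<^sup>2 * (2 * y) ^ 4"
    proof (intro mult_left_mono power_mono)
      have "1 - b\<^sup>2 = (1 - b) * (1 + b)" by (simp add: power2_eq_square algebra_simps)
      also have "\<dots> \<le> y * 2" unfolding y_def using b by (intro mult_left_mono) auto
      finally show "1 - b\<^sup>2 \<le> 2 * y" by simp
    qed (use b2 D(1) in auto)
    also have "\<dots> = 16 * D * y\<^sup>2" using y by (simp add: power_numeral_reduce)
    finally show ?thesis by (simp add: y_def)
  qed
  \<comment> \<open>The constant in \<open>carleson_measure\<close> must be positive while
    \<open>D\<close> may be 0, hence 16 D + 1.\<close>
  have "emeasure \<mu> {b..<1} \<le> ennreal ((16 * D + 1) * (1 - b) powr 2)" if "0 \<le> b" "b < 1" for b
  proof -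
    have "16 * D * (1 - b)\<^sup>2 \<le> (16 * D + 1) * (1 - b)\<^sup>2" by (intro mult_right_mono) auto
    from order_trans[OF m_le[OF that] this] show ?thesis
      using that unfolding emeasure_eq_measure by (intro ennreal_leI) (simp add: powr_numeral)
  qed
  then show ?thesis
    unfolding carleson_measure_def using D(1) by (intro exI[of _ "16 * D + 1"]) auto
qed

theorem theorem4p3:
  fixes p :: real and \<mu> :: "real measure"
  assumes "1 \<le> p" and "p \<le> 2"
    and "borel_measure_01 \<mu>"
    and "carleson_measure 1 \<mu>"
  shows "bounded_on_hardy p p (DH \<mu>) \<longleftrightarrow> carleson_measure 2 \<mu>"
proof
  interpret borel_01 \<mu> using assms(3) by unfold_locales (simp add: borel_measure_01_def)
  have fin: "finite_measure \<mu>"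
  proof
    obtain C where "\<And>t. 0 \<le> t \<Longrightarrow> t < 1 \<Longrightarrow> emeasure \<mu> {t..<1} \<le> ennreal (C * (1 - t) powr 1)"
      using assms(4) unfolding carleson_measure_def by blast
    from this[of 0] show "emeasure \<mu> (space \<mu>) \<noteq> \<infinity>"
      unfolding space_mu by (auto simp: top_unique)
  qed
  show "carleson_measure 2 \<mu>" if "bounded_on_hardy p p (DH \<mu>)"
    by (rule carleson_2_if_bounded_on_hardy[OF fin assms(1) that])
  show "bounded_on_hardy p p (DH \<mu>)" if c2: "carleson_measure 2 \<mu>"
  proof -
    obtain C where C: "C > 0" "\<And>t. 0 \<le> t \<Longrightarrow> t < 1 \<Longrightarrow> emeasure \<mu> {t..<1} \<le> ennreal (C * (1 - t) powr 2)"
      using c2 unfolding carleson_measure_def by blast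
    interpret carleson_2 \<mu> C
    proof
      show "emeasure \<mu> {t..<1} \<le> ennreal (C * (1 - t)\<^sup>2)" if "0 \<le> t" "t < 1" for t
        using C(2)[OF that] that by (simp add: powr_numeral)
    qed (rule C(1))
    show ?thesis by (rule bounded_on_hardy_DH[OF assms(1,2)])
  qed
qed

end
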